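(* For $A\in\mathcal{M}_{m\times n}(\mathbb{N})$ with non-zero columns, let $I_A\subseteq\mathbb{K}[e_1,\dots,e_n]$ be the toric ideal of $A$, and let $t\ge1$ be an integer. Then $$I_A^{(t+1)}=\ker\left(\pi^{(t)}\right)=\bigoplus_{\sigma\in\mathbb{N}^m}\ker\left(\pi^{(t)}|_{V_{A,\sigma}}\right).$$
   Context: $\mathbb{K}$ is an algebraically closed field of characteristic zero, and $\mathbb{N}$ is the set of non-negative integers. For $\alpha\in\mathbb{N}^n$, $e^\alpha=e_1^{\alpha_1}\cdots e_n^{\alpha_n}$. Let $A\in\mathcal{M}_{m\times n}(\mathbb{N})$ have columns $\varsigma_1,\dots,\varsigma_n\in\mathbb{N}^m$, all non-zero. The map $\varphi_A:\mathbb{K}[e_1,\dots,e_n]\to\mathbb{K}[x_1,\dots,x_m]$ is the $\mathbb{K}$-algebra homomorphism with $\varphi_A(e_i)=x^{\varsigma_i}$, and the toric ideal of $A$ is $I_A=\ker(\varphi_A)$, a prime ideal. For $\sigma\in\mathbb{N}^m$, the fiber of $\sigma$ is the set of monomials $e^\alpha$ with $\varphi_A(e^\alpha)=x^\sigma$, and $V_{A,\sigma}$ is the $\mathbb{K}$-vector space generated by the fiber of $\sigma$. For an integer $s\ge1$, $\pi^{(s)}:\mathbb{K}[e_1,\dots,e_n]\to\mathbb{K}^n\otimes\cdots\otimes\mathbb{K}^n$ ($s$ factors) is the $\mathbb{K}$-linear map induced by $\pi^{(s)}(e^\alpha)=\underbrace{\alpha\otimes\cdots\otimes\alpha}_{s}$,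 and $\pi^{(s)}|_{V_{A,\sigma}}$ is its restriction to $V_{A,\sigma}$. The $k$-th symbolic power of the prime ideal $I_A$ in $R=\mathbb{K}[e_1,\dots,e_n]$ is $I_A^{(k)}=I_A^kR_{I_A}\cap R=\{f\in R\mid fg\in I_A^k\text{ for some }g\notin I_A\}$.
   Formalization: The sum runs over σ≠0 only (1 lies in the σ=0 summand but not in I_A^{(t+1)}), and ker(π^{(t)}) is taken degree by degree on polynomials without constant term, since the ungraded kernel contains e_j^2-2^t e_j, which is not in I_A. *)

theory Defs
  imports "HOL-Analysis.Cartesian_Space" "HOL-Computational_Algebra.Polynomial"
    "HOL-Library.Poly_Mapping"
begin

text \<open>
  The polynomial ring \<open>\<K>[e\<^sub>1, \<dots>, e\<^sub>n]\<close> is the monoid algebra of \<open>\<nat>\<^sup>n\<close>, i.e. the type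
  \<open>(nat ^ 'n) \<Rightarrow>\<^sub>0 'k\<close> of finitely supported functions on exponent vectors with the convolution
  product; the monomial \<open>e\<^sup>\<alpha>\<close> is \<open>Poly_Mapping.single \<alpha> 1\<close>.
\<close>

type_synonym ('k, 'n) mpoly = "(nat ^ 'n) \<Rightarrow>\<^sub>0 'k"

abbreviation mpmonom :: "nat ^ 'n \<Rightarrow> ('k::comm_ring_1, 'n::finite) mpoly"
  where "mpmonom \<alpha> \<equiv> Poly_Mapping.single \<alpha> 1"

abbreviation mpconst :: "'k \<Rightarrow> ('k::comm_ring_1, 'n::finite) mpoly"
  where "mpconst c \<equiv> Poly_Mapping.single 0 c"

definition scale_mpoly :: "'k::comm_ring_1 \<Rightarrow> ('k, 'n::finite) mpoly \<Rightarrow> ('k, 'n) mpoly"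
  where "scale_mpoly c f = mpconst c * f"


definition phi :: "nat ^ 'n ^ 'm \<Rightarrow> ('k::comm_ring_1, 'n::finite) mpoly \<Rightarrow> ('k, 'm::finite) mpoly"
  where "phi A f =
    (\<Sum>\<alpha>\<in>Poly_Mapping.keys f.
      mpconst (Poly_Mapping.lookup f \<alpha>) * (\<Prod>i\<in>UNIV. mpmonom (column i A) ^ (\<alpha> $ i)))"

definition toric_ideal :: "nat ^ 'n ^ 'm \<Rightarrow> ('k::comm_ring_1, 'n::finite) mpoly set"
  where "toric_ideal A = {f. phi A f = (0 :: ('k, 'm::finite) mpoly)}"

text \<open>\<open>module.span (*)\<close> is the ideal generated by a set.\<close>

definition ideal_power :: "'r::comm_ring_1 set \<Rightarrow> nat \<Rightarrow> 'r set"
  where "ideal_power I k = module.span (*) {prod_list fs | fs. length fs = k \<and> set fs \<subseteq> I}"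

definition symbolic_power :: "'r::comm_ring_1 set \<Rightarrow> nat \<Rightarrow> 'r set"
  where "symbolic_power P k = {f. \<exists>g. g \<notin> P \<and> f * g \<in> ideal_power P k}"


definition fiber :: "nat ^ 'n ^ 'm \<Rightarrow> nat ^ 'm \<Rightarrow> ('k::comm_ring_1, 'n::finite) mpoly set"
  where "fiber A \<sigma> = {mpmonom \<alpha> | \<alpha>. phi A (mpmonom \<alpha>) = (mpmonom \<sigma> :: ('k, 'm::finite) mpoly)}"

definition fiber_space :: "nat ^ 'n ^ 'm \<Rightarrow> nat ^ 'm \<Rightarrow> ('k::comm_ring_1, 'n::finite) mpoly set"
  where "fiber_space A \<sigma> = module.span scale_mpoly (fiber A (\<sigma> :: nat ^ 'm::finite))"


text \<open>
  The \<open>s\<close>-fold tensor power of \<open>\<K>\<^sup>n\<close> is represented by coordinates with respect to the basis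
  \<open>\<epsilon>\<^bsub>j\<^sub>1\<^esub> \<otimes> \<dots> \<otimes> \<epsilon>\<^bsub>j\<^sub>s\<^esub>\<close>, where \<open>\<epsilon>\<^sub>j\<close> is the standard basis of \<open>\<K>\<^sup>n\<close>: a tensor is a function of the
  index list \<open>[j\<^sub>1, \<dots>, j\<^sub>s]\<close> that is zero on lists of any other length.
\<close>

type_synonym ('k, 'n) tensor = "'n list \<Rightarrow> 'k"

definition pure_tensor :: "('k::comm_ring_1 ^ 'n) list \<Rightarrow> ('k, 'n) tensor"
  where "pure_tensor vs =
    (\<lambda>js. if length js = length vs then (\<Prod>i<length vs. (vs ! i) $ (js ! i)) else 0)"

definition pi_map :: "nat \<Rightarrow> ('k::comm_ring_1, 'n::finite) mpoly \<Rightarrow> ('k, 'n) tensor"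
  where "pi_map s f =
    (\<lambda>js. \<Sum>\<alpha>\<in>Poly_Mapping.keys f.
      Poly_Mapping.lookup f \<alpha> * pure_tensor (replicate s (\<chi> i. of_nat (\<alpha> $ i))) js)"

definition ker_pi_on :: "nat \<Rightarrow> ('k::comm_ring_1, 'n::finite) mpoly set \<Rightarrow> ('k, 'n) mpoly set"
  where "ker_pi_on s V = {f \<in> V. pi_map s f = (\<lambda>_. 0)}"


text \<open>
  The polynomial ring is graded by \<open>\<nat>\<^sup>m\<close>, with \<open>V\<^bsub>A,\<sigma>\<^esub>\<close> in degree \<open>\<sigma>\<close>. The kernel of \<open>\<pi>\<^bsup>(s)\<^esup>\<close> that
  equals the symbolic power is the one of the graded map
  \<open>\<Oplus>\<^sub>\<sigma> V\<^bsub>A,\<sigma>\<^esub> \<rightarrow> \<Oplus>\<^sub>\<sigma> \<K>\<^sup>n \<otimes> \<dots> \<otimes> \<K>\<^sup>n\<close> that acts as \<open>\<pi>\<^bsup>(s)\<^esup>\<close> on each \<open>V\<^bsub>A,\<sigma>\<^esub>\<close>. The kernel of the ungraded map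
  is bigger, because it is not a graded subspace: it contains \<open>e\<^sub>j\<^sup>2 - 2\<^sup>s e\<^sub>j\<close>. Degree \<open>\<sigma> = 0\<close>
  has to be left out, since \<open>V\<^bsub>A,0\<^esub> = \<K>\<close> is in the kernel for \<open>s \<ge> 1\<close>. Both exclusions are
  unavoidable, see \<open>ungraded_kernel_fails\<close> and \<open>degree_zero_fails\<close> below.
\<close>

definition homogeneous_part ::
    "nat ^ 'n ^ 'm \<Rightarrow> nat ^ 'm::finite \<Rightarrow> ('k::comm_ring_1, 'n::finite) mpoly \<Rightarrow> ('k, 'n) mpoly"
  where "homogeneous_part A \<sigma> f =
    (\<Sum>\<alpha> | \<alpha> \<in> Poly_Mapping.keys f \<and> mpmonom \<alpha> \<in> (fiber A \<sigma> :: ('k, 'n) mpoly set).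
      Poly_Mapping.single \<alpha> (Poly_Mapping.lookup f \<alpha>))"

definition graded_pi ::
    "nat ^ 'n ^ 'm \<Rightarrow> nat \<Rightarrow> ('k::comm_ring_1, 'n::finite) mpoly \<Rightarrow> nat ^ 'm::finite \<Rightarrow> ('k, 'n) tensor"
  where "graded_pi A s f = (\<lambda>\<sigma>. pi_map s (homogeneous_part A \<sigma> f))"

text \<open>
  The domain is \<open>\<Oplus>\<^bsub>\<sigma> \<noteq> 0\<^esub> V\<^bsub>A,\<sigma>\<^esub>\<close>, i.e. the polynomials without constant term (the columns of \<open>A\<close>
  being non-zero).
\<close>

definition ker_graded_pi ::
    "nat ^ 'n ^ 'm::finite \<Rightarrow> nat \<Rightarrow> ('k::comm_ring_1, 'n::finite) mpoly set"
  where "ker_graded_pi A s = {f. Poly_Mapping.lookup f 0 = 0 \<and> graded_pi A s f = (\<lambda>_ _. 0)}"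

definition is_direct_sum :: "'v::comm_monoid_add set \<Rightarrow> 'i set \<Rightarrow> ('i \<Rightarrow> 'v set) \<Rightarrow> bool"
  where "is_direct_sum U J W \<longleftrightarrow>
    U = {\<Sum>j\<in>F. w j | F w. finite F \<and> F \<subseteq> J \<and> (\<forall>j\<in>F. w j \<in> W j)} \<and>
    (\<forall>F w. finite F \<and> F \<subseteq> J \<and> (\<forall>j\<in>F. w j \<in> W j) \<and> (\<Sum>j\<in>F. w j) = 0 \<longrightarrow> (\<forall>j\<in>F. w j = 0))"


lemma mpmonom_power:
  "(mpmonom \<beta> :: ('k::comm_ring_1, 'n::finite) mpoly) ^ k = mpmonom (\<chi> i. k * \<beta> $ i)"
proof (induction k)
  case 0
  have "(\<chi> i. 0 * \<beta> $ i) = 0" by (simp add: vec_eq_iff)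
  then show ?case by simp
next
  case (Suc k)
  have "\<beta> + (\<chi> i. k * \<beta> $ i) = (\<chi> i. Suc k * \<beta> $ i)" by (simp add: vec_eq_iff)
  then show ?case by (simp add: Suc Poly_Mapping.mult_single del: mult_Suc)
qed

lemma prod_mpmonom:
  fixes A :: "nat ^ 'n::finite ^ 'm::finite"
  shows "(\<Prod>i\<in>UNIV. (mpmonom (column i A) :: ('k::comm_ring_1, 'm) mpoly) ^ (\<alpha> $ i)) =
    mpmonom (A *v \<alpha>)"
proof -
  have *: "(\<Prod>i\<in>S. (mpmonom (column i A) :: ('k, 'm) mpoly) ^ (\<alpha> $ i)) =
      mpmonom (\<Sum>i\<in>S. \<chi> j. \<alpha> $ i * column i A $ j)" if "finite S" for S
    using that
    by (induction S) (simp_all add: mpmonom_power Poly_Mapping.mult_single)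
  have "(\<Sum>i\<in>UNIV. \<chi> j. \<alpha> $ i * column i A $ j) = A *v \<alpha>"
    by (simp add: vec_eq_iff matrix_vector_mult_def column_def mult.commute)
  then show ?thesis
    by (simp add: *)
qed

lemma phi_alt:
  fixes A :: "nat ^ 'n::finite ^ 'm::finite" and f :: "('k::comm_ring_1, 'n) mpoly"
  assumes "finite S" "Poly_Mapping.keys f \<subseteq> S"
  shows "phi A f = (\<Sum>\<alpha>\<in>S. Poly_Mapping.single (A *v \<alpha>) (Poly_Mapping.lookup f \<alpha>))"
proof -
  have "phi A f = (\<Sum>\<alpha>\<in>Poly_Mapping.keys f.
      Poly_Mapping.single (A *v \<alpha>) (Poly_Mapping.lookup f \<alpha>))"
    by (simp add: phi_def prod_mpmonom Poly_Mapping.mult_single)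
  also have "\<dots> = (\<Sum>\<alpha>\<in>S. Poly_Mapping.single (A *v \<alpha>) (Poly_Mapping.lookup f \<alpha>))"
    using assms by (intro sum.mono_neutral_left) (auto simp: in_keys_iff)
  finally show ?thesis .
qed

lemma phi_single:
  fixes A :: "nat ^ 'n::finite ^ 'm::finite" and c :: "'k::comm_ring_1"
  shows "phi A (Poly_Mapping.single \<alpha> c) = Poly_Mapping.single (A *v \<alpha>) c"
  by (subst phi_alt[of "{\<alpha>}"]) auto

lemma phi_add:
  fixes A :: "nat ^ 'n::finite ^ 'm::finite" and f g :: "('k::comm_ring_1, 'n) mpoly"
  shows "phi A (f + g) = phi A f + phi A g"
proof -
  let ?S = "Poly_Mapping.keys f \<union> Poly_Mapping.keys g"
  have "Poly_Mapping.keys (f + g) \<subseteq> ?S" by (rule Poly_Mapping.keys_add)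
  then show ?thesis
    by (simp add: phi_alt[of ?S] lookup_add single_add sum.distrib)
qed

lemma phi_zero: "phi A (0 :: ('k::comm_ring_1, 'n::finite) mpoly) = 0"
  by (simp add: phi_def)

lemma phi_sum: "phi A (\<Sum>i\<in>I. f i) = (\<Sum>i\<in>I. phi A (f i))"
  by (induction I rule: infinite_finite_induct) (simp_all add: phi_zero phi_add)

lemma mpoly_sum_single:
  "(f :: ('k::comm_ring_1, 'n::finite) mpoly) =
    (\<Sum>\<alpha>\<in>Poly_Mapping.keys f. Poly_Mapping.single \<alpha> (Poly_Mapping.lookup f \<alpha>))"
  by (rule poly_mapping_eqI) (simp add: lookup_sum lookup_single when_def in_keys_iff)

lemma phi_mult:
  fixes A :: "nat ^ 'n::finite ^ 'm::finite" and f g :: "('k::comm_ring_1, 'n) mpoly"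
  shows "phi A (f * g) = phi A f * phi A g"
proof -
  let ?F = "Poly_Mapping.keys f" and ?G = "Poly_Mapping.keys g"
  let ?l = "Poly_Mapping.lookup"
  have "f * g = (\<Sum>\<alpha>\<in>?F. \<Sum>\<beta>\<in>?G. Poly_Mapping.single (\<alpha> + \<beta>) (?l f \<alpha> * ?l g \<beta>))"
    by (subst mpoly_sum_single[of f], subst mpoly_sum_single[of g])
      (simp add: sum_product Poly_Mapping.mult_single)
  then have "phi A (f * g) = (\<Sum>\<alpha>\<in>?F. \<Sum>\<beta>\<in>?G.
      Poly_Mapping.single (A *v (\<alpha> + \<beta>)) (?l f \<alpha> * ?l g \<beta>))"
    by (simp add: phi_sum phi_single)
  also have "\<dots> = phi A f * phi A g"
    by (simp add: phi_alt[of ?F] phi_alt[of ?G] sum_product Poly_Mapping.mult_single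
        matrix_vector_right_distrib)
  finally show ?thesis .
qed

lemma module_times: "module ((*) :: 'r::comm_ring_1 \<Rightarrow> 'r \<Rightarrow> 'r)"
  by unfold_locales (simp_all add: algebra_simps)

lemma ideal_power_Suc_subset:
  fixes A :: "nat ^ 'n::finite ^ 'm::finite"
  shows "ideal_power (toric_ideal A :: ('k::comm_ring_1, 'n) mpoly set) (Suc k) \<subseteq> toric_ideal A"
  unfolding ideal_power_def
proof (rule module.span_minimal[OF module_times])
  show "module.subspace (*) (toric_ideal A :: ('k, 'n) mpoly set)"
    by (auto simp: module.subspace_def[OF module_times] toric_ideal_def phi_zero phi_add phi_mult)
  show "{prod_list fs |fs. length fs = Suc k \<and> set fs \<subseteq> (toric_ideal A :: ('k, 'n) mpoly set)}
      \<subseteq> toric_ideal A"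
    by (auto simp: toric_ideal_def length_Suc_conv phi_mult)
qed

lemma degree_zero_fails:
  fixes A :: "nat ^ 'n::finite ^ 'm::finite"
  assumes "t \<ge> 1"
  shows "(1 :: ('k::field_char_0, 'n) mpoly) \<in> ker_pi_on t (fiber_space A 0)"
    and "(1 :: ('k, 'n) mpoly) \<notin> symbolic_power (toric_ideal A) (t + 1)"
proof -
  have m: "module (scale_mpoly :: 'k \<Rightarrow> ('k, 'n) mpoly \<Rightarrow> ('k, 'n) mpoly)"
    by unfold_locales
      (simp_all add: scale_mpoly_def distrib_left distrib_right single_add Poly_Mapping.mult_single
        flip: mult.assoc)
  have "(1 :: ('k, 'n) mpoly) \<in> fiber A 0"
    unfolding fiber_def by (auto simp: phi_single intro!: exI[of _ 0])
  then have "(1 :: ('k, 'n) mpoly) \<in> fiber_space A 0"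
    unfolding fiber_space_def by (rule module.span_base[OF m])
  moreover have "pi_map t (1 :: ('k, 'n) mpoly) = (\<lambda>_. 0)"
    using assms by (auto simp: pi_map_def pure_tensor_def fun_eq_iff lookup_one)
  ultimately show "(1 :: ('k, 'n) mpoly) \<in> ker_pi_on t (fiber_space A 0)"
    by (simp add: ker_pi_on_def)
  show "(1 :: ('k, 'n) mpoly) \<notin> symbolic_power (toric_ideal A) (t + 1)"
    using ideal_power_Suc_subset[of A t, where 'k='k] by (auto simp: symbolic_power_def)
qed

lemma ungraded_kernel_fails:
  fixes A :: "nat ^ 'n::finite ^ 'm::finite" and t :: nat
  assumes "column j A \<noteq> 0"
  defines "f \<equiv> (mpmonom (axis j 1) ^ 2 - mpconst (2 ^ t) * mpmonom (axis j 1)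
      :: ('k::field_char_0, 'n) mpoly)"
  shows "f \<in> ker_pi_on t UNIV" and "f \<notin> symbolic_power (toric_ideal A) (t + 1)"
proof -
  have ax: "axis j 1 + axis j 1 = (axis j 2 :: nat ^ 'n)"
    by (simp add: vec_eq_iff axis_def)
  have f: "f = Poly_Mapping.single (axis j 2) 1 - Poly_Mapping.single (axis j 1) (2 ^ t)"
    by (simp add: f_def power2_eq_square Poly_Mapping.mult_single ax [unfolded One_nat_def])
  have ne: "axis j 2 \<noteq> (axis j 1 :: nat ^ 'n)"
    by (auto simp: vec_eq_iff axis_def)
  have l: "Poly_Mapping.lookup f \<alpha> = (if \<alpha> = axis j 2 then 1 else if \<alpha> = axis j 1 then - (2 ^ t) else 0)" for \<alpha>
    using ne by (auto simp: f lookup_minus lookup_single when_def)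
  have k: "Poly_Mapping.keys f = {axis j 2, axis j 1}"
    by (auto simp: in_keys_iff l split: if_splits)
  have "pi_map t f js = 0" for js
  proof (cases "length js = t")
    case True
    have 1: "of_nat ((axis j 2 :: nat ^ 'n) $ i) = (2 :: 'k) * of_nat ((axis j 1 :: nat ^ 'n) $ i)" for i
      by (simp add: axis_def)
    show ?thesis using ne True
      by (simp add: pi_map_def k l pure_tensor_def 1 prod.distrib)
  next
    case False
    then show ?thesis by (simp add: pi_map_def pure_tensor_def)
  qed
  then show "f \<in> ker_pi_on t UNIV"
    by (auto simp: ker_pi_on_def)
  show "f \<notin> symbolic_power (toric_ideal A) (t + 1)"
  proof
    assume "f \<in> symbolic_power (toric_ideal A) (t + 1)"
    then obtain g where g: "phi A g \<noteq> (0 :: ('k, 'm) mpoly)" "phi A (f * g) = (0 :: ('k, 'm) mpoly)"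
      using ideal_power_Suc_subset[of A t, where 'k='k]
      by (auto simp: symbolic_power_def toric_ideal_def)
    define h where "h = phi A g"
    let ?v = "column j A" and ?l = "Poly_Mapping.lookup"
    have Aj: "A *v axis j 1 = ?v" "A *v axis j 2 = ?v + ?v"
      by (auto simp: vec_eq_iff matrix_vector_mult_def column_def axis_def if_distrib
          cong: if_cong)
    have "phi A f + phi A (Poly_Mapping.single (axis j 1) (2 ^ t) :: ('k, 'n) mpoly) =
        phi A (Poly_Mapping.single (axis j 2) 1)"
      by (simp add: f flip: phi_add)
    then have "phi A f = Poly_Mapping.single (?v + ?v) 1 - Poly_Mapping.single ?v (2 ^ t :: 'k)"
      by (simp add: phi_single Aj [unfolded One_nat_def] eq_diff_eq)
    then have eq: "Poly_Mapping.single (?v + ?v) 1 * h = Poly_Mapping.single ?v (2 ^ t) * h"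
      using g(2) by (simp add: phi_mult h_def left_diff_distrib)
    have look: "?l (Poly_Mapping.single \<beta> c * h) (\<beta> + \<gamma>) = c * ?l h \<gamma>" for \<beta> \<gamma> and c :: 'k
    proof -
      have "Poly_Mapping.single \<beta> c * h =
          (\<Sum>\<alpha>\<in>Poly_Mapping.keys h. Poly_Mapping.single (\<beta> + \<alpha>) (c * ?l h \<alpha>))"
        by (subst mpoly_sum_single[of h]) (simp add: sum_distrib_left Poly_Mapping.mult_single)
      then show ?thesis
        by (simp add: lookup_sum lookup_single when_def in_keys_iff)
    qed
    have step: "?v + \<gamma> \<in> Poly_Mapping.keys h" if "\<gamma> \<in> Poly_Mapping.keys h" for \<gamma>
    proof -
      have "?l h \<gamma> = 2 ^ t * ?l h (?v + \<gamma>)"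
        using arg_cong[OF eq, of "\<lambda>p. ?l p (?v + ?v + \<gamma>)"] look[of "?v + ?v" 1 \<gamma>]
          look[of ?v "2 ^ t" "?v + \<gamma>"] by (simp add: add.assoc)
      then show ?thesis using that by (auto simp: in_keys_iff)
    qed
    obtain \<gamma> where \<gamma>: "\<gamma> \<in> Poly_Mapping.keys h"
      using g(1) by (metis h_def ex_in_conv keys_eq_empty)
    obtain i where i: "?v $ i \<noteq> 0"
      using assms by (auto simp: vec_eq_iff)
    have "\<exists>\<gamma>\<in>Poly_Mapping.keys h. \<gamma> $ i \<ge> k" for k
    proof (induction k)
      case 0
      then show ?case using \<gamma> by auto
    next
      case (Suc k)
      then obtain \<delta> where "\<delta> \<in> Poly_Mapping.keys h" "\<delta> $ i \<ge> k" by auto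
      then show ?case using i step[of \<delta>] by (intro bexI[of _ "?v + \<delta>"]) auto
    qed
    moreover have "finite ((\<lambda>\<gamma>. \<gamma> $ i) ` Poly_Mapping.keys h)" by simp
    ultimately show False
      by (metis Max_ge imageI not_less_eq_eq order_trans)
  qed
qed

end

theory Submission
  imports Defs
begin

text \<open>
  For \<open>k \<ge> 1\<close> the symbolic power \<open>I\<^bsup>(k)\<^esup>\<close> of a prime ideal \<open>I\<close> of a polynomial ring in characteristic zero
  consists of the polynomials that vanish to order \<open>k\<close> along the variety of \<open>I\<close>. For a toric ideal the
  order can be measured by the Euler derivations \<open>theta i = e\<^sub>i \<partial>/\<partial>e\<^sub>i\<close>, since the generic point of the
  variety is in the torus: \<open>f\<close> is in \<open>I\<^bsup>(t+1)\<^esup>\<close> if and only if all products of at most \<open>t\<close> of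
  the \<open>theta i\<close> take \<open>f\<close> into \<open>I\<close> (\<open>symbolic_power_iff_theta\<close>). The derivations are diagonal on monomials, and
  a polynomial is in \<open>I\<close> if and only if its coefficients add up to zero on each fiber. The condition
  therefore says that, on each fiber, the coefficients of \<open>f\<close> are orthogonal to all monomial functions
  \<open>\<alpha> \<mapsto> \<alpha>\<^bsub>j1\<^esub> \<dots> \<alpha>\<^bsub>js\<^esub>\<close> with \<open>s \<le> t\<close>. Those with \<open>s = t\<close> are the entries of the tensor \<open>\<alpha> \<otimes> \<dots> \<otimes> \<alpha>\<close>, and they
  suffice on the fiber of \<open>\<sigma> \<noteq> 0\<close> because a row of \<open>A\<close> is a linear form with a non-zero constant value
  there (\<open>moment_lower_degree\<close>).

  One direction of the criterion is the Leibniz rule (\<open>derivation_symbolic_power\<close>). The other one rests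
  on an analogue of Euler's formula. There are a derivation \<open>E = \<Sum>\<^sub>i w\<^sub>i (theta i)\<close> with coefficients in \<open>I\<close>
  and an element \<open>h\<close> outside \<open>I\<close> such that \<open>E f\<close> is \<open>h f\<close> modulo \<open>I\<^bsup>(2)\<^esup>\<close> for all \<open>f\<close> in \<open>I\<close>
  (\<open>exists_euler_derivation\<close>). By the Leibniz rule it acts as \<open>k h\<close> on \<open>I\<^bsup>(k)\<^esup>\<close> modulo \<open>I\<^bsup>(k+1)\<^esup>\<close>
  (\<open>euler_derivation_symbolic_power\<close>). If \<open>f\<close> and the derivatives \<open>theta i f\<close> are in \<open>I\<^bsup>(k)\<^esup>\<close>, then \<open>E f\<close> is in
  \<open>I\<^bsup>(k+1)\<^esup>\<close>, and so is \<open>k h f\<close>, hence \<open>f\<close> if \<open>k \<ge> 1\<close>. To find \<open>E\<close>, note that \<open>u \<mapsto> e\<^sup>u - 1\<close> is additive modulo the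
  square of the ideal on the lattice of the vectors \<open>u\<close> with \<open>A u = 0\<close>: it is the first-order logarithm of
  \<open>e\<^sup>u\<close>. An additive map from a lattice to a rational vector space extends to the ambient lattice
  (\<open>exists_linear_log\<close>), and \<open>w\<^sub>i\<close> is \<open>h\<close> times the value of the extension at the \<open>i\<close>-th basis vector.

  The decomposition of the kernel as a direct sum holds because the kernel is taken degree by degree.
\<close>

section \<open>Symbolic powers of a prime ideal and derivations\<close>

locale prime_ideal =
  fixes P :: "'r::comm_ring_1 set"
  assumes zero_mem: "0 \<in> P"
    and add_mem: "f \<in> P \<Longrightarrow> g \<in> P \<Longrightarrow> f + g \<in> P"
    and mult_mem: "f \<in> P \<Longrightarrow> r * f \<in> P"
    and one_notin: "1 \<notin> P"
    and prime_mem: "f * g \<in> P \<Longrightarrow> f \<in> P \<or> g \<in> P"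
begin

abbreviation Q :: "nat \<Rightarrow> 'r set" where "Q k \<equiv> symbolic_power P k"

lemma ideal_power_zero: "0 \<in> ideal_power P k"
  unfolding ideal_power_def by (rule module.span_zero[OF module_times])

lemma ideal_power_add: "f \<in> ideal_power P k \<Longrightarrow> g \<in> ideal_power P k \<Longrightarrow> f + g \<in> ideal_power P k"
  unfolding ideal_power_def by (rule module.span_add[OF module_times])

lemma ideal_power_mult: "f \<in> ideal_power P k \<Longrightarrow> r * f \<in> ideal_power P k"
  unfolding ideal_power_def by (rule module.span_scale[OF module_times])

lemma ideal_power_0: "f \<in> ideal_power P 0"
proof -
  have "1 \<in> ideal_power P 0"
    unfolding ideal_power_def by (rule module.span_base[OF module_times]) auto
  then show ?thesis using ideal_power_mult[of 1 0 f] by simp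
qed

lemma mult_mem_ideal_power_Suc:
  assumes "a \<in> P" "f \<in> ideal_power P k"
  shows "a * f \<in> ideal_power P (Suc k)"
  using assms(2) unfolding ideal_power_def[of P k]
proof (induction rule: module.span_induct_alt[OF module_times, consumes 1])
  case 1
  then show ?case by (simp add: ideal_power_zero)
next
  case (2 c x y)
  then obtain fs where fs: "x = prod_list fs" "length fs = k" "set fs \<subseteq> P" by blast
  have "prod_list (a # fs) \<in> ideal_power P (Suc k)"
    unfolding ideal_power_def
    by (rule module.span_base[OF module_times])
      (use fs assms(1) in \<open>force intro: exI[of _ "a # fs"]\<close>)
  then have "c * prod_list (a # fs) + a * y \<in> ideal_power P (Suc k)"
    by (intro ideal_power_add ideal_power_mult 2)
  then show ?case by (simp add: fs algebra_simps)
qed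

text \<open>
  The ideal \<open>P\<^bsup>k+1\<^esup>\<close> is additively generated by products of an element of \<open>P\<close> and an element of \<open>P\<^bsup>k\<^esup>\<close>,
  since a ring coefficient can be absorbed in the first factor. The induction thus needs no case for
  scalar multiples, which matters below: the properties of interest involve derivations, and these
  are not linear over the ring.
\<close>
lemma ideal_power_Suc_induct [consumes 1, case_names zero add mult]:
  assumes "f \<in> ideal_power P (Suc k)"
    and "R 0"
    and "\<And>f g. R f \<Longrightarrow> R g \<Longrightarrow> R (f + g)"
    and mult: "\<And>a f. a \<in> P \<Longrightarrow> f \<in> ideal_power P k \<Longrightarrow> R (a * f)"
  shows "R f"
  using assms(1) unfolding ideal_power_def
proof (induction rule: module.span_induct_alt[OF module_times, consumes 1])
  case 1
  then show ?case by (rule assms)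
next
  case (2 c x y)
  then obtain fs where fs: "x = prod_list fs" "length fs = Suc k" "set fs \<subseteq> P" by blast
  then obtain a gs where a: "fs = a # gs" "length gs = k" by (auto simp: length_Suc_conv)
  have "prod_list gs \<in> ideal_power P k"
    unfolding ideal_power_def
    by (rule module.span_base[OF module_times]) (use fs a in auto)
  then have "R ((c * a) * prod_list gs)"
    using fs a by (intro mult mult_mem) auto
  then show ?case
    using assms(3)[OF _ 2(2)] by (simp add: fs a mult.assoc)
qed

lemma ideal_power_mult_add:
  "f \<in> ideal_power P j \<Longrightarrow> g \<in> ideal_power P k \<Longrightarrow> f * g \<in> ideal_power P (j + k)"
proof (induction j arbitrary: f)
  case 0
  then show ?case by (simp add: ideal_power_mult)
next
  case (Suc j)
  from Suc.prems(1) show ?case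
    by (induction rule: ideal_power_Suc_induct)
      (simp_all add: ideal_power_zero ideal_power_add distrib_right mult.assoc
        mult_mem_ideal_power_Suc Suc.IH Suc.prems(2))
qed

lemma ideal_power_Suc_le: "f \<in> ideal_power P (Suc k) \<Longrightarrow> f \<in> ideal_power P k"
  by (induction rule: ideal_power_Suc_induct)
    (auto intro: ideal_power_zero ideal_power_add ideal_power_mult)

lemma symbolic_powerI: "g \<notin> P \<Longrightarrow> f * g \<in> ideal_power P k \<Longrightarrow> f \<in> Q k"
  by (auto simp: symbolic_power_def)

lemma ideal_power_subset_symbolic_power: "f \<in> ideal_power P k \<Longrightarrow> f \<in> Q k"
  by (rule symbolic_powerI[OF one_notin]) simp

lemma symbolic_power_zero: "0 \<in> Q k"
  by (intro ideal_power_subset_symbolic_power ideal_power_zero)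

lemma symbolic_power_0: "f \<in> Q 0"
  by (intro ideal_power_subset_symbolic_power ideal_power_0)

text \<open>
  Primality enters here: the two summands have different denominators, and their product must stay
  outside \<open>P\<close>.
\<close>
lemma symbolic_power_add:
  assumes "f \<in> Q k" "g \<in> Q k"
  shows "f + g \<in> Q k"
proof -
  from assms obtain u v where u: "u \<notin> P" "f * u \<in> ideal_power P k"
    and v: "v \<notin> P" "g * v \<in> ideal_power P k"
    by (auto simp: symbolic_power_def)
  have "v * (f * u) + u * (g * v) \<in> ideal_power P k"
    by (intro ideal_power_add ideal_power_mult u v)
  then have "(f + g) * (u * v) \<in> ideal_power P k" by (simp add: algebra_simps)
  then show ?thesis using u v prime_mem by (intro symbolic_powerI[of "u * v"]) auto
qed

lemma symbolic_power_mult_add: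
  assumes "f \<in> Q j" "g \<in> Q k"
  shows "f * g \<in> Q (j + k)"
proof -
  from assms obtain u v where u: "u \<notin> P" "f * u \<in> ideal_power P j"
    and v: "v \<notin> P" "g * v \<in> ideal_power P k"
    by (auto simp: symbolic_power_def)
  have "(f * u) * (g * v) \<in> ideal_power P (j + k)"
    by (intro ideal_power_mult_add u v)
  then have "(f * g) * (u * v) \<in> ideal_power P (j + k)" by (simp add: algebra_simps)
  then show ?thesis using u v prime_mem by (intro symbolic_powerI[of "u * v"]) auto
qed

lemma symbolic_power_mult: "f \<in> Q k \<Longrightarrow> r * f \<in> Q k"
  using symbolic_power_mult_add[OF symbolic_power_0, of f k r] by simp

lemma symbolic_power_minus: "f \<in> Q k \<Longrightarrow> - f \<in> Q k"
  using symbolic_power_mult[of f k "-1"] by simp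

lemma symbolic_power_diff: "f \<in> Q k \<Longrightarrow> g \<in> Q k \<Longrightarrow> f - g \<in> Q k"
  using symbolic_power_add[of f k "-g"] symbolic_power_minus[of g k] by simp

lemma symbolic_power_sum: "(\<And>i. i \<in> S \<Longrightarrow> f i \<in> Q k) \<Longrightarrow> (\<Sum>i\<in>S. f i) \<in> Q k"
  by (induction S rule: infinite_finite_induct)
    (simp_all add: symbolic_power_zero symbolic_power_add)

text \<open>
  Symbolic powers are saturated with respect to the complement of \<open>P\<close>. Everything that holds only up
  to a denominator in the localisation is brought back to the ring by this rule.
\<close>
lemma symbolic_power_cancel:
  assumes "g \<notin> P" "g * f \<in> Q k"
  shows "f \<in> Q k"
proof -
  from assms obtain u where "u \<notin> P" "g * f * u \<in> ideal_power P k"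
    by (auto simp: symbolic_power_def)
  then show ?thesis
    using assms(1) prime_mem by (intro symbolic_powerI[of "g * u"]) (auto simp: mult_ac)
qed

lemma symbolic_power_Suc_le: "f \<in> Q (Suc k) \<Longrightarrow> f \<in> Q k"
  by (auto simp: symbolic_power_def intro: ideal_power_Suc_le)

lemma symbolic_power_one: "Q (Suc 0) = P"
proof
  have "f \<in> P" if "f \<in> ideal_power P (Suc 0)" for f
    using that
  proof (induction rule: ideal_power_Suc_induct)
    case (mult a f)
    then show ?case using mult_mem[of a f] by (simp add: mult.commute)
  qed (auto intro: zero_mem add_mem)
  then show "Q (Suc 0) \<subseteq> P"
    using prime_mem by (auto simp: symbolic_power_def)
  show "P \<subseteq> Q (Suc 0)"
    using mult_mem_ideal_power_Suc[of _ 1 0] ideal_power_0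
    by (force intro: ideal_power_subset_symbolic_power)
qed

lemma symbolic_power_Suc_subset: "f \<in> Q (Suc k) \<Longrightarrow> f \<in> P"
proof (induction k)
  case 0
  then show ?case using symbolic_power_one by simp
qed (blast intro: symbolic_power_Suc_le)

lemma mult_mem_symbolic_power_Suc: "a \<in> P \<Longrightarrow> f \<in> Q k \<Longrightarrow> a * f \<in> Q (Suc k)"
  using symbolic_power_mult_add[of a "Suc 0" f k] by (simp add: symbolic_power_one)

lemma mult_mem_symbolic_power_2: "a \<in> P \<Longrightarrow> b \<in> P \<Longrightarrow> a * b \<in> Q 2"
  using mult_mem_symbolic_power_Suc[of a b "Suc 0"] by (simp add: symbolic_power_one numeral_2_eq_2)

end

definition derivation :: "('r::comm_ring_1 \<Rightarrow> 'r) \<Rightarrow> bool"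
  where "derivation D \<longleftrightarrow>
    (\<forall>f g. D (f + g) = D f + D g) \<and> (\<forall>f g. D (f * g) = D f * g + f * D g)"

lemma derivation_add: "derivation D \<Longrightarrow> D (f + g) = D f + D g"
  and derivation_mult: "derivation D \<Longrightarrow> D (f * g) = D f * g + f * D g"
  by (simp_all add: derivation_def)

lemma derivation_zero: "derivation D \<Longrightarrow> D 0 = 0"
  using derivation_add[of D 0 0] by simp

context prime_ideal
begin

text \<open>
  By the Leibniz rule, a derivation takes a product of \<open>k + 1\<close> elements of \<open>P\<close> to a sum of products that
  still have \<open>k\<close> factors in \<open>P\<close>. Denominators are handled by
  \<open>g (D f) = D (f g) - (D g) f\<close>, whose last term is controlled by the previous symbolic power.
\<close>
lemma derivation_symbolic_power:
  assumes D: "derivation D" and f: "f \<in> Q (Suc k)"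
  shows "D f \<in> Q k"
  using f
proof (induction k arbitrary: f)
  case 0
  then show ?case by (simp add: symbolic_power_0)
next
  case (Suc k)
  have power: "D p \<in> Q (Suc k)" if "p \<in> ideal_power P (Suc (Suc k))" for p
    using that
  proof (induction rule: ideal_power_Suc_induct)
    case (mult a q)
    then have q: "q \<in> Q (Suc k)" by (simp add: ideal_power_subset_symbolic_power)
    then have "a * D q \<in> Q (Suc k)"
      using mult(1) by (intro mult_mem_symbolic_power_Suc Suc.IH)
    then show ?case
      by (simp add: derivation_mult[OF D] symbolic_power_add symbolic_power_mult q)
  qed (simp_all add: derivation_zero[OF D] derivation_add[OF D] symbolic_power_zero
      symbolic_power_add)
  from Suc.prems obtain g where g: "g \<notin> P" "f * g \<in> ideal_power P (Suc (Suc k))"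
    by (auto simp: symbolic_power_def)
  have "D (f * g) - D g * f \<in> Q (Suc k)"
    by (intro symbolic_power_diff symbolic_power_mult power g symbolic_power_Suc_le[OF Suc.prems])
  then have "g * D f \<in> Q (Suc k)" by (simp add: derivation_mult[OF D] algebra_simps)
  then show ?case using g symbolic_power_cancel by blast
qed

text \<open>
  Euler's formula for the filtration by symbolic powers. If \<open>D\<close> maps into \<open>P\<close> and acts on \<open>P\<close> modulo
  \<open>Q 2\<close> as multiplication by \<open>h\<close>, then, like the Euler operator on forms of degree \<open>k\<close>, it acts on
  \<open>Q k\<close> modulo \<open>Q (k + 1)\<close> as multiplication by \<open>k h\<close>: each of the \<open>k\<close> factors contributes \<open>h\<close> once.
\<close>
lemma euler_derivation_symbolic_power:
  assumes D: "derivation D" and DP: "\<And>f. D f \<in> P"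
    and euler: "\<And>f. f \<in> P \<Longrightarrow> D f - h * f \<in> Q 2"
    and f: "f \<in> Q k"
  shows "D f - of_nat k * h * f \<in> Q (Suc k)"
proof -
  have power: "D p - of_nat k * h * p \<in> Q (Suc k)" if "p \<in> ideal_power P k" for p k
    using that
  proof (induction k arbitrary: p)
    case 0
    then show ?case using DP by (simp add: symbolic_power_one)
  next
    case (Suc k)
    from Suc.prems show ?case
    proof (induction rule: ideal_power_Suc_induct)
      case zero
      then show ?case by (simp add: derivation_zero[OF D] symbolic_power_zero)
    next
      case (add p q)
      then have "(D p - of_nat (Suc k) * h * p) + (D q - of_nat (Suc k) * h * q) \<in> Q (Suc (Suc k))"
        by (rule symbolic_power_add)
      then show ?case by (simp add: derivation_add[OF D] algebra_simps)
    next
      case (mult a q)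
      have "q * (D a - h * a) \<in> Q (k + 2)"
        using mult by (intro symbolic_power_mult_add ideal_power_subset_symbolic_power euler)
      moreover have "a * (D q - of_nat k * h * q) \<in> Q (Suc (Suc k))"
        using mult by (intro mult_mem_symbolic_power_Suc Suc.IH)
      ultimately have "q * (D a - h * a) + a * (D q - of_nat k * h * q) \<in> Q (Suc (Suc k))"
        by (intro symbolic_power_add) simp_all
      then show ?case by (simp add: derivation_mult[OF D] algebra_simps)
    qed
  qed
  from f obtain g where g: "g \<notin> P" "f * g \<in> ideal_power P k"
    by (auto simp: symbolic_power_def)
  have "(D (f * g) - of_nat k * h * (f * g)) - D g * f \<in> Q (Suc k)"
    by (intro symbolic_power_diff power g mult_mem_symbolic_power_Suc DP f)
  then have "g * (D f - of_nat k * h * f) \<in> Q (Suc k)"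
    by (simp add: derivation_mult[OF D] algebra_simps)
  then show ?thesis using g symbolic_power_cancel by blast
qed

end

section \<open>Toric ideals and Euler derivations\<close>

text \<open>
  The linear map of monoid algebras that is induced by a map \<open>h\<close> of exponents; a ring homomorphism
  when \<open>h\<close> is additive.
\<close>
definition pushforward :: "('a \<Rightarrow> 'b) \<Rightarrow> ('a \<Rightarrow>\<^sub>0 'k::comm_monoid_add) \<Rightarrow> ('b \<Rightarrow>\<^sub>0 'k)"
  where "pushforward h f =
    (\<Sum>\<alpha>\<in>Poly_Mapping.keys f. Poly_Mapping.single (h \<alpha>) (Poly_Mapping.lookup f \<alpha>))"

lemma pushforward_superset:
  assumes "finite S" "Poly_Mapping.keys f \<subseteq> S"
  shows "pushforward h f = (\<Sum>\<alpha>\<in>S. Poly_Mapping.single (h \<alpha>) (Poly_Mapping.lookup f \<alpha>))"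
  unfolding pushforward_def
  using assms by (intro sum.mono_neutral_left) (auto simp: in_keys_iff)

lemma pushforward_single [simp]:
  "pushforward h (Poly_Mapping.single \<alpha> c) = Poly_Mapping.single (h \<alpha>) c"
  by (subst pushforward_superset[of "{\<alpha>}"]) auto

lemma pushforward_zero [simp]: "pushforward h 0 = 0"
  by (simp add: pushforward_def)

lemma pushforward_add: "pushforward h (f + g) = pushforward h f + pushforward h g"
proof -
  let ?S = "Poly_Mapping.keys f \<union> Poly_Mapping.keys g"
  have "Poly_Mapping.keys (f + g) \<subseteq> ?S" by (rule Poly_Mapping.keys_add)
  then show ?thesis
    by (simp add: pushforward_superset[of ?S] lookup_add single_add sum.distrib)
qed

lemma pushforward_sum: "pushforward h (\<Sum>i\<in>I. f i) = (\<Sum>i\<in>I. pushforward h (f i))"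
  by (induction I rule: infinite_finite_induct) (simp_all add: pushforward_add)

lemma pushforward_comp: "pushforward g (pushforward h f) = pushforward (\<lambda>\<alpha>. g (h \<alpha>)) f"
  by (simp add: pushforward_def[of h] pushforward_def[of "\<lambda>\<alpha>. g (h \<alpha>)"] pushforward_sum)

lemma sum_singles:
  "(f :: 'a \<Rightarrow>\<^sub>0 'k::comm_monoid_add) =
    (\<Sum>\<alpha>\<in>Poly_Mapping.keys f. Poly_Mapping.single \<alpha> (Poly_Mapping.lookup f \<alpha>))"
  by (rule poly_mapping_eqI) (simp add: lookup_sum lookup_single when_def in_keys_iff)

lemma pushforward_mult:
  fixes f g :: "'a::monoid_add \<Rightarrow>\<^sub>0 'k::comm_ring_1" and h :: "'a \<Rightarrow> 'b::monoid_add"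
  assumes h: "\<And>\<alpha> \<beta>. h (\<alpha> + \<beta>) = h \<alpha> + h \<beta>"
  shows "pushforward h (f * g) = pushforward h f * pushforward h g"
proof -
  let ?F = "Poly_Mapping.keys f" and ?G = "Poly_Mapping.keys g"
  let ?l = "Poly_Mapping.lookup"
  have "f * g = (\<Sum>\<alpha>\<in>?F. \<Sum>\<beta>\<in>?G. Poly_Mapping.single (\<alpha> + \<beta>) (?l f \<alpha> * ?l g \<beta>))"
    by (subst sum_singles[of f], subst sum_singles[of g])
      (simp add: sum_product Poly_Mapping.mult_single)
  then have "pushforward h (f * g) = (\<Sum>\<alpha>\<in>?F. \<Sum>\<beta>\<in>?G.
      Poly_Mapping.single (h \<alpha> + h \<beta>) (?l f \<alpha> * ?l g \<beta>))"
    by (simp add: pushforward_sum h)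
  also have "\<dots> = pushforward h f * pushforward h g"
    by (simp add: pushforward_def sum_product Poly_Mapping.mult_single)
  finally show ?thesis .
qed

lemma lookup_pushforward:
  "Poly_Mapping.lookup (pushforward h f) \<beta> =
    (\<Sum>\<alpha> | \<alpha> \<in> Poly_Mapping.keys f \<and> h \<alpha> = \<beta>. Poly_Mapping.lookup f \<alpha>)"
  by (simp add: pushforward_def lookup_sum lookup_single when_def flip: sum.inter_filter)

lemma pushforward_eq_zero_iff:
  assumes "inj h"
  shows "pushforward h f = 0 \<longleftrightarrow> f = 0"
proof
  assume *: "pushforward h f = 0"
  show "f = 0"
  proof (rule poly_mapping_eqI)
    fix \<alpha>
    have "{\<beta>. \<beta> \<in> Poly_Mapping.keys f \<and> h \<beta> = h \<alpha>} = {\<alpha>} \<inter> Poly_Mapping.keys f"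
      using assms by (auto dest: injD)
    then have "Poly_Mapping.lookup (pushforward h f) (h \<alpha>) =
        sum (Poly_Mapping.lookup f) ({\<alpha>} \<inter> Poly_Mapping.keys f)"
      by (simp add: lookup_pushforward)
    also have "\<dots> = Poly_Mapping.lookup f \<alpha>"
      by (cases "\<alpha> \<in> Poly_Mapping.keys f") (auto simp: in_keys_iff)
    finally show "Poly_Mapping.lookup f \<alpha> = Poly_Mapping.lookup 0 \<alpha>" by (simp add: *)
  qed
qed simp

text \<open>
  A monoid algebra over a linearly ordered cancellative monoid has no zero divisors, but exponent
  vectors \<open>nat ^ 'n\<close> carry only the componentwise order. Numbering the variables embeds them in the
  linearly ordered monoid \<open>nat \<Rightarrow>\<^sub>0 nat\<close>.
\<close>
lemma mpoly_no_zero_divisors: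
  fixes f g :: "('k::idom, 'n::finite) mpoly"
  assumes "f * g = 0"
  shows "f = 0 \<or> g = 0"
proof -
  obtain idx :: "'n \<Rightarrow> nat" where idx: "inj idx"
    using finite_imp_inj_to_nat_seg[of "UNIV :: 'n set"] by auto
  define \<iota> :: "nat ^ 'n \<Rightarrow> nat \<Rightarrow>\<^sub>0 nat"
    where "\<iota> \<alpha> = (\<Sum>i\<in>UNIV. Poly_Mapping.single (idx i) (\<alpha> $ i))" for \<alpha>
  have add: "\<iota> (\<alpha> + \<beta>) = \<iota> \<alpha> + \<iota> \<beta>" for \<alpha> \<beta>
    by (simp add: \<iota>_def single_add sum.distrib)
  have "Poly_Mapping.lookup (\<iota> \<alpha>) (idx i) = \<alpha> $ i" for \<alpha> i
    using idx by (simp add: \<iota>_def lookup_sum lookup_single when_def inj_eq)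
  then have inj: "inj \<iota>"
    by (intro injI) (metis vec_eq_iff)
  have "pushforward \<iota> f * pushforward \<iota> g = 0"
    using assms by (simp add: add flip: pushforward_mult)
  then show ?thesis by (simp add: pushforward_eq_zero_iff[OF inj])
qed

lemma phi_eq_pushforward:
  fixes A :: "nat ^ 'n::finite ^ 'm::finite" and f :: "('k::comm_ring_1, 'n) mpoly"
  shows "phi A f = pushforward ((*v) A) f"
  by (simp add: phi_alt[OF finite_keys order_refl] pushforward_def)

lemma mem_toric_ideal_iff:
  fixes A :: "nat ^ 'n::finite ^ 'm::finite" and f :: "('k::comm_ring_1, 'n) mpoly"
  shows "f \<in> toric_ideal A \<longleftrightarrow>
    (\<forall>\<sigma>. (\<Sum>\<alpha> | \<alpha> \<in> Poly_Mapping.keys f \<and> A *v \<alpha> = \<sigma>. Poly_Mapping.lookup f \<alpha>) = 0)"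
  by (simp add: toric_ideal_def phi_eq_pushforward poly_mapping_eq_iff fun_eq_iff
      lookup_pushforward)

lemma single_notin_toric_ideal:
  fixes A :: "nat ^ 'n::finite ^ 'm::finite" and c :: "'k::comm_ring_1"
  shows "c \<noteq> 0 \<Longrightarrow> Poly_Mapping.single \<alpha> c \<notin> toric_ideal A"
  by (auto simp: toric_ideal_def phi_single
      dest: arg_cong[of _ _ "\<lambda>p. Poly_Mapping.lookup p (A *v \<alpha>)"])

lemma prime_ideal_toric_ideal:
  fixes A :: "nat ^ 'n::finite ^ 'm::finite"
  shows "prime_ideal (toric_ideal A :: ('k::idom, 'n) mpoly set)"
proof
  show "1 \<notin> (toric_ideal A :: ('k, 'n) mpoly set)"
    using single_notin_toric_ideal[of "1 :: 'k" 0 A] by simp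
  show "f * g \<in> toric_ideal A \<Longrightarrow> f \<in> toric_ideal A \<or> g \<in> toric_ideal A"
    for f g :: "('k, 'n) mpoly"
    by (simp add: toric_ideal_def phi_mult mpoly_no_zero_divisors)
qed (simp_all add: toric_ideal_def phi_zero phi_add phi_mult)

text \<open>
  Choose a representative of each fiber and replace every monomial of \<open>f\<close> by the representative of its
  fiber. The result is the image of \<open>phi A f = 0\<close> under a linear map, so \<open>f\<close> is the sum of the
  differences, and these are the binomials in the last case.
\<close>
lemma toric_ideal_induct [consumes 1, case_names zero add binomial]:
  fixes A :: "nat ^ 'n::finite ^ 'm::finite" and f :: "('k::comm_ring_1, 'n) mpoly"
  assumes f: "f \<in> toric_ideal A"
    and zero: "R 0"
    and add: "\<And>f g. R f \<Longrightarrow> R g \<Longrightarrow> R (f + g)"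
    and binomial: "\<And>a b c. A *v a = A *v b \<Longrightarrow>
      R (Poly_Mapping.single a c - Poly_Mapping.single b c)"
  shows "R f"
proof -
  let ?K = "Poly_Mapping.keys f" and ?l = "Poly_Mapping.lookup f"
  define rep where "rep \<sigma> = (SOME b. A *v b = \<sigma>)" for \<sigma>
  have rep: "A *v rep (A *v a) = A *v a" for a
    unfolding rep_def by (rule someI) simp
  have "pushforward (\<lambda>\<alpha>. rep (A *v \<alpha>)) f = 0"
    using f by (simp add: toric_ideal_def phi_eq_pushforward flip: pushforward_comp)
  then have "f = (\<Sum>\<alpha>\<in>?K. Poly_Mapping.single \<alpha> (?l \<alpha>)) -
      (\<Sum>\<alpha>\<in>?K. Poly_Mapping.single (rep (A *v \<alpha>)) (?l \<alpha>))"
    using sum_singles[of f] by (simp add: pushforward_def)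
  then have eq: "(\<Sum>\<alpha>\<in>?K. Poly_Mapping.single \<alpha> (?l \<alpha>) -
      Poly_Mapping.single (rep (A *v \<alpha>)) (?l \<alpha>)) = f"
    by (simp add: sum_subtractf)
  have "R (\<Sum>\<alpha>\<in>S. Poly_Mapping.single \<alpha> (?l \<alpha>) -
      Poly_Mapping.single (rep (A *v \<alpha>)) (?l \<alpha>))" if "finite S" for S
    using that by (induction S) (simp_all add: zero add binomial rep)
  from this[OF finite_keys, of f] show ?thesis unfolding eq .
qed

text \<open>
  The Euler derivation \<open>e\<^sub>i \<partial>/\<partial>e\<^sub>i\<close>. Its eigenvectors are the monomials, with the coordinates of the
  exponents as eigenvalues; this is how the tensors \<open>\<alpha> \<otimes> \<dots> \<otimes> \<alpha>\<close> come in.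
\<close>
definition theta :: "'n \<Rightarrow> ('k::comm_ring_1, 'n::finite) mpoly \<Rightarrow> ('k, 'n) mpoly"
  where "theta i f = Poly_Mapping.mapp (\<lambda>\<alpha> c. of_nat (\<alpha> $ i) * c) f"

lemma lookup_theta: "Poly_Mapping.lookup (theta i f) \<alpha> = of_nat (\<alpha> $ i) * Poly_Mapping.lookup f \<alpha>"
  by (simp add: theta_def lookup_mapp when_def in_keys_iff)

lemma theta_single: "theta i (Poly_Mapping.single \<alpha> c) = Poly_Mapping.single \<alpha> (of_nat (\<alpha> $ i) * c)"
  by (rule poly_mapping_eqI) (auto simp: lookup_theta lookup_single when_def)

lemma theta_add: "theta i (f + g) = theta i f + theta i g"
  by (rule poly_mapping_eqI) (simp add: lookup_theta lookup_add algebra_simps)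

lemma theta_zero: "theta i 0 = 0"
  by (rule poly_mapping_eqI) (simp add: lookup_theta)

lemma theta_sum: "theta i (\<Sum>j\<in>J. f j) = (\<Sum>j\<in>J. theta i (f j))"
  by (induction J rule: infinite_finite_induct) (simp_all add: theta_zero theta_add)

lemma derivation_theta: "derivation (theta i :: ('k::comm_ring_1, 'n::finite) mpoly \<Rightarrow> _)"
  unfolding derivation_def
proof safe
  fix f g :: "('k, 'n) mpoly"
  show "theta i (f + g) = theta i f + theta i g" by (rule theta_add)
  let ?m = "\<lambda>f \<alpha>. Poly_Mapping.single \<alpha> (Poly_Mapping.lookup f \<alpha>)"
  let ?F = "Poly_Mapping.keys f" and ?G = "Poly_Mapping.keys g"
  have "theta i (?m f \<alpha> * ?m g \<beta>) = theta i (?m f \<alpha>) * ?m g \<beta> + ?m f \<alpha> * theta i (?m g \<beta>)" for \<alpha> \<beta>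
    by (simp add: Poly_Mapping.mult_single theta_single algebra_simps flip: single_add)
  then have "theta i ((\<Sum>\<alpha>\<in>?F. ?m f \<alpha>) * (\<Sum>\<beta>\<in>?G. ?m g \<beta>)) =
      theta i (\<Sum>\<alpha>\<in>?F. ?m f \<alpha>) * (\<Sum>\<beta>\<in>?G. ?m g \<beta>) +
      (\<Sum>\<alpha>\<in>?F. ?m f \<alpha>) * theta i (\<Sum>\<beta>\<in>?G. ?m g \<beta>)"
    by (simp add: sum_product theta_sum sum.distrib)
  then show "theta i (f * g) = theta i f * g + f * theta i g"
    by (simp flip: mpoly_sum_single)
qed

section \<open>The first-order logarithm\<close>

text \<open>
  The locale fixes the coefficient field together with the matrix: without the type argument, each
  occurrence of the ideal \<open>I\<close> would have coefficients of its own type.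
\<close>
locale toric =
  fixes A :: "nat ^ 'n::finite ^ 'm::finite" and coeff_type :: "'k::field_char_0 itself"
begin

abbreviation I :: "('k, 'n) mpoly set" where "I \<equiv> toric_ideal A"

sublocale prime_ideal I by (rule prime_ideal_toric_ideal)

lemma mpmonom_notin: "mpmonom a \<notin> I"
  by (rule single_notin_toric_ideal) simp

lemma of_nat_notin: "n > 0 \<Longrightarrow> of_nat n \<notin> I"
  using single_notin_toric_ideal[of "of_nat n :: 'k" 0 A] by simp

lemma binomial_mem: "A *v a = A *v b \<Longrightarrow> Poly_Mapping.single a c - Poly_Mapping.single b c \<in> I"
proof -
  assume "A *v a = A *v b"
  then have "phi A (Poly_Mapping.single a c + Poly_Mapping.single b (- c)) = 0"
    by (simp add: phi_add phi_single flip: single_add)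
  then show ?thesis by (simp add: toric_ideal_def single_uminus)
qed

text \<open>
  If \<open>A a = A b\<close>, then in the localisation of the ring at \<open>I\<close> the unit \<open>e\<^bsup>b-a\<^esup>\<close> is \<open>1\<close> modulo \<open>I\<close>, hence \<open>1 - e\<^bsup>b-a\<^esup>\<close> agrees
  modulo \<open>I\<^sup>2\<close> with the logarithm of \<open>e\<^bsup>a-b\<^esup>\<close>. The predicate says that \<open>w\<close> represents \<open>h\<close> times this logarithm,
  with the denominator \<open>e\<^sup>a\<close> cleared. The following lemmas are the additivity of the logarithm in \<open>a - b\<close>.
\<close>
definition log_of :: "('k, 'n) mpoly \<Rightarrow> nat ^ 'n \<Rightarrow> nat ^ 'n \<Rightarrow> ('k, 'n) mpoly \<Rightarrow> bool"
  where "log_of h a b w \<longleftrightarrow> A *v a = A *v b \<and> w \<in> I \<and>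
    mpmonom a * w - h * (mpmonom a - mpmonom b) \<in> Q 2"

lemma log_of_refl: "log_of h a a 0"
  by (simp add: log_of_def zero_mem symbolic_power_zero)

text \<open>
  The error of additivity is \<open>h (e\<^sup>a - e\<^sup>b) (e\<^sup>c - e\<^sup>d)\<close>, a product of two elements of \<open>I\<close>.
\<close>
lemma log_of_add:
  assumes "log_of h a b w" "log_of h c d w'"
  shows "log_of h (a + c) (b + d) (w + w')"
proof -
  let ?e = "mpmonom :: nat ^ 'n \<Rightarrow> ('k, 'n) mpoly"
  have "?e c * (?e a * w - h * (?e a - ?e b)) + ?e a * (?e c * w' - h * (?e c - ?e d))
      + h * ((?e a - ?e b) * (?e c - ?e d)) \<in> Q 2"
    using assms unfolding log_of_def
    by (intro symbolic_power_add symbolic_power_mult mult_mem_symbolic_power_2 binomial_mem) auto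
  moreover have e: "?e (x + y) = ?e x * ?e y" for x y
    by (simp add: Poly_Mapping.mult_single)
  have "?e c * (?e a * w - h * (?e a - ?e b)) + ?e a * (?e c * w' - h * (?e c - ?e d))
      + h * ((?e a - ?e b) * (?e c - ?e d))
      = ?e (a + c) * (w + w') - h * (?e (a + c) - ?e (b + d))"
    unfolding e by (simp add: algebra_simps)
  ultimately show ?thesis
    using assms by (simp add: log_of_def add_mem matrix_vector_right_distrib)
qed

lemma log_of_cancel:
  assumes "log_of h (a + c) (b + c) w"
  shows "log_of h a b w"
proof -
  let ?e = "mpmonom :: nat ^ 'n \<Rightarrow> ('k, 'n) mpoly"
  have e: "?e (x + y) = ?e x * ?e y" for x y
    by (simp add: Poly_Mapping.mult_single)
  have "?e (a + c) * w - h * (?e (a + c) - ?e (b + c)) = ?e c * (?e a * w - h * (?e a - ?e b))"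
    unfolding e by (simp add: algebra_simps)
  then have "?e c * (?e a * w - h * (?e a - ?e b)) \<in> Q 2"
    using assms unfolding log_of_def by argo
  then have "?e a * w - h * (?e a - ?e b) \<in> Q 2"
    by (rule symbolic_power_cancel[OF mpmonom_notin])
  then show ?thesis
    using assms by (simp add: log_of_def matrix_vector_right_distrib)
qed

lemma log_of_minus:
  assumes "log_of h a b w"
  shows "log_of h b a (- w)"
proof -
  let ?e = "mpmonom :: nat ^ 'n \<Rightarrow> ('k, 'n) mpoly"
  have "(?e a - ?e b) * w \<in> Q 2"
    using assms unfolding log_of_def by (intro mult_mem_symbolic_power_2 binomial_mem) auto
  then have "(?e a - ?e b) * w - (?e a * w - h * (?e a - ?e b)) \<in> Q 2"
    using assms by (simp add: log_of_def symbolic_power_diff)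
  moreover have "(?e a - ?e b) * w - (?e a * w - h * (?e a - ?e b)) =
      ?e b * (- w) - h * (?e b - ?e a)"
    by (simp add: algebra_simps)
  ultimately show ?thesis
    using assms mult_mem[of w "-1"] by (simp add: log_of_def)
qed

lemma log_of_multiple:
  assumes "log_of h a b w"
  shows "log_of h (n *s a) (n *s b) (of_nat n * w)"
proof (induction n)
  case 0
  have "0 *s a = 0 *s b" by (simp add: vec_eq_iff)
  then show ?case by (simp add: log_of_refl)
next
  case (Suc n)
  have "Suc n *s x = x + n *s x" for x :: "nat ^ 'n" by (simp add: vec_eq_iff)
  then show ?case using log_of_add[OF assms Suc] by (simp add: algebra_simps)
qed

text \<open>
  Logarithms are unique modulo \<open>Q 2\<close>. With the factor \<open>h e\<^sup>a\<close> in place of \<open>h\<close> the pair \<open>(a, b)\<close> has the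
  obvious logarithm \<open>h (e\<^sup>a - e\<^sup>b)\<close>; its \<open>n\<close>-fold multiple must agree with the given logarithm of
  \<open>(n a, n b)\<close> multiplied by \<open>e\<^sup>a\<close>, and \<open>n\<close> can be cancelled in characteristic zero.
\<close>
lemma log_of_divide:
  assumes n: "n > 0" and ab: "A *v a = A *v b" and w: "w \<in> I"
    and log: "log_of h (n *s a) (n *s b) (of_nat n * w)"
  shows "log_of h a b w"
proof -
  let ?e = "mpmonom :: nat ^ 'n \<Rightarrow> ('k, 'n) mpoly"
  let ?v = "h * (?e a - ?e b)"
  have "log_of (h * ?e a) a b ?v"
    using ab by (simp add: log_of_def mult_mem binomial_mem symbolic_power_zero mult_ac)
  then have "log_of (h * ?e a) (n *s a) (n *s b) (of_nat n * ?v)"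
    by (rule log_of_multiple)
  then have "?e a * (?e (n *s a) * (of_nat n * w) - h * (?e (n *s a) - ?e (n *s b)))
      - (?e (n *s a) * (of_nat n * ?v) - h * ?e a * (?e (n *s a) - ?e (n *s b))) \<in> Q 2"
    using log by (simp only: log_of_def symbolic_power_diff symbolic_power_mult)
  moreover have "?e a * (?e (n *s a) * (of_nat n * w) - h * (?e (n *s a) - ?e (n *s b)))
      - (?e (n *s a) * (of_nat n * ?v) - h * ?e a * (?e (n *s a) - ?e (n *s b)))
      = (?e (n *s a) * of_nat n) * (?e a * w - ?v)"
    by (simp add: algebra_simps)
  ultimately have "(?e (n *s a) * of_nat n) * (?e a * w - ?v) \<in> Q 2"
    by argo
  moreover have "?e (n *s a) * of_nat n \<notin> I"
    using prime_mem mpmonom_notin of_nat_notin[OF n] by blast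
  ultimately have "?e a * w - ?v \<in> Q 2" by (rule symbolic_power_cancel[rotated])
  then show ?thesis using ab w by (simp add: log_of_def)
qed

definition rat_diff :: "nat ^ 'n \<Rightarrow> nat ^ 'n \<Rightarrow> rat ^ 'n"
  where "rat_diff a b = (\<chi> i. of_nat (a $ i) - of_nat (b $ i))"

definition rat_scale :: "rat \<Rightarrow> ('k, 'n) mpoly \<Rightarrow> ('k, 'n) mpoly"
  where "rat_scale q f = mpconst (of_rat q) * f"

lemma vector_space_rat_scale: "vector_space rat_scale"
  by unfold_locales
    (simp_all add: rat_scale_def distrib_left distrib_right of_rat_add of_rat_mult single_add
      Poly_Mapping.mult_single flip: mult.assoc)

lemma rat_scale_of_nat: "rat_scale (of_nat n) f = of_nat n * f"
  by (simp add: rat_scale_def)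

text \<open>
  Additivity of the logarithm carries the property from \<open>B\<close> to its span. As a vector of the rational span
  need not be a difference of exponents, the subspace \<open>U\<close> to which the span is compared asks for a
  logarithm of some positive integer multiple only; \<open>log_of_divide\<close> removes the multiple at the end.
\<close>
lemma linear_log_on_span:
  fixes W :: "rat ^ 'n \<Rightarrow> ('k, 'n) mpoly"
  assumes W: "Vector_Spaces.linear (*s) rat_scale W" and WI: "\<And>u. W u \<in> I"
    and B: "\<And>u. u \<in> B \<Longrightarrow> \<exists>a b. u = rat_diff a b \<and> log_of h a b (W u)"
    and span: "rat_diff a b \<in> vec.span B" and ab: "A *v a = A *v b"
  shows "log_of h a b (W (rat_diff a b))"
proof -
  interpret W: Vector_Spaces.linear "(*s)" rat_scale W by (rule W)
  define U where "U = {u. \<exists>s>0. \<exists>a b. of_nat s *s u = rat_diff a b \<and> log_of h a b (of_nat s * W u)}"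
  have UI: "u \<in> U" if "s > 0" "of_nat s *s u = rat_diff a b" "log_of h a b (of_nat s * W u)" for s u a b
    using that by (auto simp: U_def)
  have "vec.subspace U"
  proof (rule vec.subspaceI)
    show "0 \<in> U"
      by (rule UI[of 1 _ 0 0]) (simp_all add: rat_diff_def vec_eq_iff W.zero log_of_refl)
  next
    fix u v assume "u \<in> U" "v \<in> U"
    then obtain s a b s' a' b' where
      u: "s > 0" "of_nat s *s u = rat_diff a b" "log_of h a b (of_nat s * W u)" and
      v: "s' > 0" "of_nat s' *s v = rat_diff a' b'" "log_of h a' b' (of_nat s' * W v)"
      unfolding U_def by blast
    show "u + v \<in> U"
    proof (rule UI[of "s * s'" _ "s' *s a + s *s a'" "s' *s b + s *s b'"])
      show "of_nat (s * s') *s (u + v) = rat_diff (s' *s a + s *s a') (s' *s b + s *s b')"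
      proof -
        have i: "of_nat s * u $ i = of_nat (a $ i) - of_nat (b $ i)"
            "of_nat s' * v $ i = of_nat (a' $ i) - of_nat (b' $ i)" for i
          using u(2) v(2) by (simp_all add: vec_eq_iff rat_diff_def)
        have "of_nat (s * s') * (u $ i + v $ i) =
            of_nat s' * (of_nat s * u $ i) + of_nat s * (of_nat s' * v $ i)" for i
          by (simp add: algebra_simps)
        then show ?thesis
          unfolding i by (simp add: vec_eq_iff rat_diff_def algebra_simps)
      qed
      show "log_of h (s' *s a + s *s a') (s' *s b + s *s b') (of_nat (s * s') * W (u + v))"
        using log_of_add[OF log_of_multiple[OF u(3), of s'] log_of_multiple[OF v(3), of s]]
        by (simp add: W.add algebra_simps)
    qed (use u v in simp)
  next
    fix q :: rat and u assume "u \<in> U"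
    then obtain s a b where
      u: "s > 0" "of_nat s *s u = rat_diff a b" "log_of h a b (of_nat s * W u)"
      unfolding U_def by blast
    have "\<exists>r r' :: nat. r' > 0 \<and> (q = of_nat r / of_nat r' \<or> q = - (of_nat r / of_nat r'))"
    proof -
      obtain m n where mn: "quotient_of q = (m, n)" by force
      then have "q = of_int m / of_int n" "n > 0"
        by (simp_all add: quotient_of_div quotient_of_denom_pos)
      then show ?thesis
        by (intro exI[of _ "nat \<bar>m\<bar>"] exI[of _ "nat n"]) (auto simp: abs_if)
    qed
    then obtain r r' where r': "r' > 0" and q: "q = of_nat r / of_nat r' \<or> q = - (of_nat r / of_nat r')"
      by blast
    let ?s = "s * r'"
    have Wq: "of_nat r' * W (q *s u) = rat_scale (of_nat r' * q) (W u)"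
      by (simp add: W.scale flip: rat_scale_of_nat)
    have log: "log_of h (r *s a) (r *s b) (of_nat s * (of_nat r * W u))"
      using log_of_multiple[OF u(3), of r] by (simp add: mult_ac)
    have eq: "of_nat r *s (of_nat s *s u) = rat_diff (r *s a) (r *s b)"
      unfolding u(2) by (simp add: vec_eq_iff rat_diff_def algebra_simps)
    from q show "q *s u \<in> U"
    proof
      assume q: "q = of_nat r / of_nat r'"
      then have rq: "of_nat r' * q = of_nat r" using r' by simp
      have "of_nat ?s *s (q *s u) = of_nat s *s ((of_nat r' * q) *s u)"
        by (simp add: vec_eq_iff)
      also have "\<dots> = rat_diff (r *s a) (r *s b)"
        unfolding rq using eq by (simp add: vec_eq_iff mult_ac)
      finally show ?thesis
        using u r' log Wq by (intro UI[of ?s]) (simp_all add: rq rat_scale_of_nat mult.assoc)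
    next
      assume q: "q = - (of_nat r / of_nat r')"
      then have rq: "of_nat r' * q = - of_nat r" using r' by simp
      have "of_nat ?s *s (q *s u) = of_nat s *s ((of_nat r' * q) *s u)"
        by (simp add: vec_eq_iff)
      also have "\<dots> = - rat_diff (r *s a) (r *s b)"
        unfolding rq using eq by (simp add: vec_eq_iff mult_ac)
      also have "\<dots> = rat_diff (r *s b) (r *s a)"
        by (simp add: rat_diff_def vec_eq_iff)
      finally have 1: "of_nat ?s *s (q *s u) = rat_diff (r *s b) (r *s a)" .
      have "of_nat r' * W (q *s u) = - (of_nat r * W u)"
        unfolding Wq rq by (simp add: rat_scale_def of_rat_minus single_uminus)
      then have "of_nat ?s * W (q *s u) = - (of_nat s * (of_nat r * W u))"
        by (simp add: mult.assoc)
      then show ?thesis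
        using u r' log_of_minus[OF log] 1 by (intro UI[of ?s]) simp_all
    qed
  qed
  moreover have "B \<subseteq> U"
    using B by (force intro: UI[of 1])
  ultimately have "rat_diff a b \<in> U"
    using span vec.span_minimal by blast
  then obtain s a' b' where s: "s > 0" "of_nat s *s rat_diff a b = rat_diff a' b'"
    "log_of h a' b' (of_nat s * W (rat_diff a b))"
    unfolding U_def by blast
  \<comment> \<open>Subtraction is moved to the other side, as the exponents are natural numbers.\<close>
  have "of_nat ((s *s a + b') $ i) = (of_nat ((s *s b + a') $ i) :: rat)" for i
    using s(2) by (simp add: vec_eq_iff rat_diff_def algebra_simps)
  then have eq: "s *s a + b' = s *s b + a'"
    unfolding of_nat_eq_iff by (simp add: vec_eq_iff)
  have "log_of h (a' + s *s b) (b' + s *s b) (of_nat s * W (rat_diff a b) + 0)"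
    by (intro log_of_add s log_of_refl)
  then have "log_of h (s *s a + b') (s *s b + b') (of_nat s * W (rat_diff a b))"
    unfolding eq by (simp add: add.commute)
  then have "log_of h (s *s a) (s *s b) (of_nat s * W (rat_diff a b))"
    by (rule log_of_cancel)
  then show ?thesis by (rule log_of_divide[OF s(1) ab WI])
qed

text \<open>
  The logarithm is defined on differences in the kernel of \<open>A\<close> only, but the Euler derivation needs it
  on every \<open>e\<^sub>i\<close>. As the target is a rational vector space, it extends: choose a basis \<open>B\<close> of the span of
  the differences among them, prescribe the logarithms there and extend linearly by zero on a
  complement.
\<close>
lemma exists_linear_log:
  "\<exists>h. \<exists>W :: rat ^ 'n \<Rightarrow> ('k, 'n) mpoly. h \<notin> I \<and> Vector_Spaces.linear (*s) rat_scale W \<and>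
    (\<forall>u. W u \<in> I) \<and> (\<forall>a b. A *v a = A *v b \<longrightarrow> log_of h a b (W (rat_diff a b)))"
proof -
  let ?e = "mpmonom :: nat ^ 'n \<Rightarrow> ('k, 'n) mpoly"
  interpret vector_space_pair "(*s) :: rat \<Rightarrow> rat ^ 'n \<Rightarrow> _" rat_scale
    by (intro vector_space_pair.intro vector_space_rat_scale vec.vector_space_axioms)
  define L where "L = {rat_diff a b | a b. A *v a = A *v b}"
  obtain B where B: "B \<subseteq> L" "vec.independent B" "L \<subseteq> vec.span B"
    using vec.maximal_independent_subset by blast
  have fin: "finite B" using B(2) by (rule vec.finiteI_independent)
  have "\<forall>u\<in>B. \<exists>a b. u = rat_diff a b \<and> A *v a = A *v b"
    using B(1) by (auto simp: L_def)
  then obtain p r where pr: "\<And>u. u \<in> B \<Longrightarrow> u = rat_diff (p u) (r u) \<and> A *v p u = A *v r u"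
    by metis
  \<comment> \<open>The common denominator of the logarithms \<open>1 - e\<^bsup>r u - p u\<^esup>\<close> of the basis elements.\<close>
  define h where "h = (\<Prod>u\<in>B. ?e (p u))"
  define g where "g u = (\<Prod>v\<in>B - {u}. ?e (p v)) * (?e (p u) - ?e (r u))" for u
  define W where "W = construct B g"
  have W: "Vector_Spaces.linear (*s) rat_scale W"
    unfolding W_def by (rule linear_construct[OF B(2)])
  have gI: "g u \<in> I" if "u \<in> B" for u
    using pr[OF that] by (simp add: g_def mult_mem binomial_mem)
  have "vs2.subspace I"
    by (rule vs2.subspaceI) (simp_all add: zero_mem add_mem mult_mem rat_scale_def)
  then have "vs2.span (g ` B) \<subseteq> I"
    using gI by (intro vs2.span_minimal) auto
  then have WI: "W u \<in> I" for u
    using construct_in_span[OF B(2), of g u] by (auto simp: W_def)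
  have "(\<Prod>u\<in>S. ?e (p u)) \<notin> I" if "finite S" for S
    using that by induction (use one_notin prime_mem mpmonom_notin in auto)
  then have hI: "h \<notin> I" unfolding h_def using fin by blast
  have log: "log_of h (p u) (r u) (W u)" if u: "u \<in> B" for u
  proof -
    have "W u = g u" using u B(2) by (simp add: W_def construct_basis)
    moreover have "h = ?e (p u) * (\<Prod>v\<in>B - {u}. ?e (p v))"
      unfolding h_def using fin u by (rule prod.remove)
    ultimately have "?e (p u) * W u - h * (?e (p u) - ?e (r u)) = 0"
      by (simp add: g_def mult_ac)
    then show ?thesis using WI pr[OF u] by (simp add: log_of_def symbolic_power_zero)
  qed
  have "log_of h a b (W (rat_diff a b))" if ab: "A *v a = A *v b" for a b
  proof (rule linear_log_on_span[OF W WI _ _ ab])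
    show "rat_diff a b \<in> vec.span B" using B(3) ab by (auto simp: L_def)
  qed (use pr log in blast)
  then show ?thesis using hI W WI by blast
qed

text \<open>
  Take for \<open>w i\<close> the extended logarithm of \<open>e\<^sub>i\<close>. On a binomial \<open>e\<^sup>a - e\<^sup>b\<close> in \<open>I\<close> the derivation is
  \<open>e\<^sup>a (V a) - e\<^sup>b (V b)\<close>, where \<open>V a\<close> is the logarithm of \<open>e\<^sup>a\<close>. This is \<open>e\<^sup>a (V a - V b)\<close> up to
  \<open>(e\<^sup>a - e\<^sup>b) (V b) \<in> I\<^sup>2\<close>, and \<open>V a - V b\<close> is the logarithm of \<open>e\<^bsup>a-b\<^esup>\<close>.
\<close>
lemma exists_euler_derivation:
  "\<exists>h. \<exists>w :: 'n \<Rightarrow> ('k, 'n) mpoly. h \<notin> I \<and> (\<forall>i. w i \<in> I) \<and>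
    (\<forall>f\<in>I. (\<Sum>i\<in>UNIV. w i * theta i f) - h * f \<in> Q 2)"
proof -
  let ?e = "mpmonom :: nat ^ 'n \<Rightarrow> ('k, 'n) mpoly"
  obtain h and W :: "rat ^ 'n \<Rightarrow> ('k, 'n) mpoly" where h: "h \<notin> I"
    and W: "Vector_Spaces.linear (*s) rat_scale W" and WI: "\<And>u. W u \<in> I"
    and log: "\<And>a b. A *v a = A *v b \<Longrightarrow> log_of h a b (W (rat_diff a b))"
    using exists_linear_log by blast
  interpret W: Vector_Spaces.linear "(*s)" rat_scale W by (rule W)
  define w where "w i = W (axis i 1)" for i
  define V where "V a = W (rat_diff a 0)" for a
  have V: "V a = (\<Sum>i\<in>UNIV. of_nat (a $ i) * w i)" for a
  proof -
    have "rat_diff a 0 = (\<Sum>i\<in>UNIV. of_nat (a $ i) *s axis i 1)"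
      by (subst basis_expansion[symmetric]) (simp add: rat_diff_def)
    then show ?thesis by (simp add: V_def w_def W.sum W.scale rat_scale_of_nat)
  qed
  define E where "E f = (\<Sum>i\<in>UNIV. w i * theta i f)" for f
  have E_single: "E (Poly_Mapping.single a c) = Poly_Mapping.single a c * V a" for a c
  proof -
    have "theta i (Poly_Mapping.single a c) = of_nat (a $ i) * Poly_Mapping.single a c" for i
      by (simp add: theta_single Poly_Mapping.mult_single flip: single_of_nat)
    then show ?thesis by (simp add: E_def V sum_distrib_left mult_ac)
  qed
  have E_add: "E (f + g) = E f + E g" for f g
    by (simp add: E_def theta_add distrib_left sum.distrib)
  have "E f - h * f \<in> Q 2" if "f \<in> I" for f
    using that
  proof (induction rule: toric_ideal_induct)
      case zero
      then show ?case by (simp add: E_def theta_zero symbolic_power_zero)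
    next
      case (add f g)
      then have "(E f - h * f) + (E g - h * g) \<in> Q 2" by (rule symbolic_power_add)
      then show ?case by (simp add: E_add algebra_simps)
    next
      case (binomial a b c)
      have "rat_diff a b = rat_diff a 0 - rat_diff b 0"
        by (simp add: rat_diff_def vec_eq_iff)
      then have "log_of h a b (V a - V b)"
        using log[OF binomial] by (simp add: V_def W.diff)
      then have "mpconst c * ((?e a * (V a - V b) - h * (?e a - ?e b)) + (?e a - ?e b) * V b) \<in> Q 2"
        using binomial WI
        by (intro symbolic_power_mult symbolic_power_add mult_mem_symbolic_power_2 binomial_mem)
          (auto simp: log_of_def V_def)
      moreover have s: "Poly_Mapping.single x c = mpconst c * ?e x" for x
        by (simp add: Poly_Mapping.mult_single)
      have sub: "E (Poly_Mapping.single a c - Poly_Mapping.single b c) =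
          Poly_Mapping.single a c * V a - Poly_Mapping.single b c * V b"
        using E_add[of "Poly_Mapping.single a c - Poly_Mapping.single b c" "Poly_Mapping.single b c"]
        by (simp add: E_single)
      ultimately show ?case unfolding sub unfolding s[of a] s[of b] by (simp add: algebra_simps)
  qed
  then show ?thesis
    using h WI unfolding E_def w_def by (intro exI[of _ h] exI conjI) auto
qed

end

section \<open>The differential criterion for symbolic powers\<close>

text \<open>
  The coordinate with index \<open>js\<close> of \<open>\<pi>\<^bsup>(s)\<^esup>\<close> on the part of \<open>f\<close> in the fiber of \<open>\<sigma>\<close>, for \<open>s\<close> the length of
  \<open>js\<close>.
\<close>
definition moment :: "nat ^ 'n::finite ^ 'm::finite \<Rightarrow> nat ^ 'm \<Rightarrow> 'n list \<Rightarrow> ('k::comm_ring_1, 'n) mpoly \<Rightarrow> 'k"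
  where "moment A \<sigma> js f = (\<Sum>\<alpha> | \<alpha> \<in> Poly_Mapping.keys f \<and> A *v \<alpha> = \<sigma>.
    (\<Prod>j\<leftarrow>js. of_nat (\<alpha> $ j)) * Poly_Mapping.lookup f \<alpha>)"

lemma lookup_foldr_theta:
  "Poly_Mapping.lookup (foldr theta js f) \<alpha> =
    (\<Prod>j\<leftarrow>js. of_nat (\<alpha> $ j)) * Poly_Mapping.lookup f \<alpha>"
  by (induction js) (simp_all add: lookup_theta mult.assoc)

lemma foldr_theta_mem_toric_ideal_iff:
  "foldr theta js f \<in> toric_ideal A \<longleftrightarrow> (\<forall>\<sigma>. moment A \<sigma> js f = 0)"
proof -
  have "(\<Sum>\<alpha> | \<alpha> \<in> Poly_Mapping.keys (foldr theta js f) \<and> A *v \<alpha> = \<sigma>.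
      Poly_Mapping.lookup (foldr theta js f) \<alpha>) = moment A \<sigma> js f" for \<sigma>
    unfolding moment_def lookup_foldr_theta[symmetric]
    by (rule sum.mono_neutral_left) (auto simp: in_keys_iff lookup_foldr_theta)
  then show ?thesis by (simp add: mem_toric_ideal_iff)
qed

context toric
begin

text \<open>
  The theorem of Zariski and Nagata for toric ideals, with differential operators replaced by products
  of the derivations \<open>theta\<close>. For the converse, let \<open>f\<close> satisfy the condition for \<open>k + 1\<close>. By induction
  \<open>f\<close> and all \<open>theta i f\<close> are in \<open>Q k\<close>, hence \<open>E f\<close> is in \<open>Q (k + 1)\<close>, as \<open>E\<close> has coefficients in \<open>I\<close>.
  Since \<open>E f\<close> is also \<open>k h f\<close> modulo \<open>Q (k + 1)\<close>, the factor \<open>k h\<close> can be cancelled; this is division by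
  \<open>k\<close>, so the case \<open>k = 0\<close> is separate.
\<close>
theorem symbolic_power_iff_theta:
  fixes f :: "('k, 'n) mpoly"
  shows "f \<in> Q k \<longleftrightarrow> (\<forall>js. length js < k \<longrightarrow> foldr theta js f \<in> I)"
proof safe
  fix js :: "'n list" assume f: "f \<in> Q k" and js: "length js < k"
  have "foldr theta js f \<in> Q (k - length js)"
    using js
  proof (induction js)
    case (Cons j js)
    then have "k - length js = Suc (k - length (j # js))" by simp
    moreover have "foldr theta js f \<in> Q (k - length js)" using Cons by simp
    ultimately show ?case
      using derivation_symbolic_power[OF derivation_theta] by simp
  qed (simp add: f)
  moreover obtain l where "k - length js = Suc l" using js by (metis Suc_diff_Suc)
  ultimately show "foldr theta js f \<in> I" using symbolic_power_Suc_subset by simp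
next
  obtain h and w :: "'n \<Rightarrow> ('k, 'n) mpoly" where h: "h \<notin> I" and w: "\<And>i. w i \<in> I"
    and lin: "\<And>f. f \<in> I \<Longrightarrow> (\<Sum>i\<in>UNIV. w i * theta i f) - h * f \<in> Q 2"
    using exists_euler_derivation by blast
  define E where "E f = (\<Sum>i\<in>UNIV. w i * theta i f)" for f
  have der: "derivation E"
    unfolding derivation_def E_def
    by (simp add: theta_add derivation_mult[OF derivation_theta] distrib_left sum.distrib
        sum_distrib_left sum_distrib_right mult_ac)
  have "(\<Sum>i\<in>S. w i * g i) \<in> I" for g S
    using w by (induction S rule: infinite_finite_induct)
      (simp_all add: zero_mem add_mem mult_mem mult.commute[of "w _"])
  then have "E f \<in> I" for f by (simp add: E_def)
  then have euler: "f \<in> Q k \<Longrightarrow> E f - of_nat k * h * f \<in> Q (Suc k)" for f k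
    using lin unfolding E_def[symmetric]
    by (rule euler_derivation_symbolic_power[OF der])
  assume "\<forall>js. length js < k \<longrightarrow> foldr theta js f \<in> I"
  then show "f \<in> Q k"
  proof (induction k arbitrary: f)
    case 0
    then show ?case by (simp add: symbolic_power_0)
  next
    case (Suc k)
    show ?case
    proof (cases "k = 0")
      case True
      then show ?thesis
        using Suc.prems[rule_format, of "[]"] by (simp add: symbolic_power_one)
    next
      case False
      have f: "f \<in> Q k" using Suc.prems by (intro Suc.IH) simp
      have "theta i f \<in> Q k" for i
      proof (rule Suc.IH, safe)
        fix js :: "'n list" assume "length js < k"
        then show "foldr theta js (theta i f) \<in> I"
          using Suc.prems[rule_format, of "js @ [i]"] by simp
      qed
      then have "E f \<in> Q (Suc k)"
        unfolding E_def by (intro symbolic_power_sum mult_mem_symbolic_power_Suc w)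
      then have "E f - (E f - of_nat k * h * f) \<in> Q (Suc k)"
        using euler[OF f] by (rule symbolic_power_diff)
      then have "(of_nat k * h) * f \<in> Q (Suc k)" by simp
      moreover have "of_nat k * h \<notin> I" using of_nat_notin h prime_mem False by blast
      ultimately show ?thesis by (rule symbolic_power_cancel[rotated])
    qed
  qed
qed

end

section \<open>The graded kernel\<close>

lemma matrix_vector_eq_zero_iff:
  fixes A :: "nat ^ 'n::finite ^ 'm::finite"
  assumes "\<And>i. column i A \<noteq> 0"
  shows "A *v \<alpha> = 0 \<longleftrightarrow> \<alpha> = 0"
proof
  assume *: "A *v \<alpha> = 0"
  show "\<alpha> = 0"
  proof (subst vec_eq_iff, safe)
    fix i
    obtain r where r: "A $ r $ i \<noteq> 0"
      using assms[of i] by (auto simp: vec_eq_iff column_def)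
    have "(\<Sum>j\<in>UNIV. A $ r $ j * \<alpha> $ j) = 0"
      using * by (simp add: vec_eq_iff matrix_vector_mult_def)
    then have "A $ r $ i * \<alpha> $ i = 0" by simp
    then show "\<alpha> $ i = 0 $ i" using r by simp
  qed
qed (simp add: matrix_vector_mult_def vec_eq_iff)

text \<open>
  On the fiber of \<open>\<sigma> \<noteq> 0\<close> some row of \<open>A\<close> is a linear form in \<open>\<alpha>\<close> with a non-zero constant value, so a
  moment of lower degree is a multiple of a combination of moments of the next degree.
\<close>
lemma moment_lower_degree:
  fixes A :: "nat ^ 'n::finite ^ 'm::finite" and f :: "('k::field_char_0, 'n) mpoly"
  assumes \<sigma>: "\<sigma> \<noteq> 0" and top: "\<And>js. length js = t \<Longrightarrow> moment A \<sigma> js f = 0"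
    and js: "length js \<le> t"
  shows "moment A \<sigma> js f = 0"
  using js
proof (induction "t - length js" arbitrary: js)
  case 0
  then show ?case by (simp add: top)
next
  case (Suc l)
  obtain r where r: "\<sigma> $ r \<noteq> 0" using \<sigma> by (auto simp: vec_eq_iff)
  let ?c = "\<lambda>\<alpha>. (\<Prod>j\<leftarrow>js. of_nat (\<alpha> $ j)) * Poly_Mapping.lookup f \<alpha>"
  have row: "of_nat ((A *v \<alpha>) $ r) * c = (\<Sum>i\<in>UNIV. of_nat (A $ r $ i) * (of_nat (\<alpha> $ i) * c))"
    for \<alpha> and c :: 'k
    by (simp add: matrix_vector_mult_def sum_distrib_right mult.assoc)
  have "of_nat (\<sigma> $ r) * moment A \<sigma> js f =
      (\<Sum>\<alpha> | \<alpha> \<in> Poly_Mapping.keys f \<and> A *v \<alpha> = \<sigma>. of_nat ((A *v \<alpha>) $ r) * ?c \<alpha>)"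
    by (simp add: moment_def sum_distrib_left)
  also have "\<dots> = (\<Sum>\<alpha> | \<alpha> \<in> Poly_Mapping.keys f \<and> A *v \<alpha> = \<sigma>.
      \<Sum>i\<in>UNIV. of_nat (A $ r $ i) * (of_nat (\<alpha> $ i) * ?c \<alpha>))"
    by (simp only: row)
  also have "\<dots> = (\<Sum>i\<in>UNIV. of_nat (A $ r $ i) * moment A \<sigma> (i # js) f)"
    by (subst sum.swap) (simp add: moment_def sum_distrib_left mult.assoc)
  also have "\<dots> = 0"
    using Suc by (intro sum.neutral) (auto intro!: Suc.hyps(1))
  finally show ?case using r by simp
qed

lemma mem_fiber_iff:
  fixes A :: "nat ^ 'n::finite ^ 'm::finite"
  shows "(mpmonom \<alpha> :: ('k::comm_ring_1, 'n) mpoly) \<in> fiber A \<sigma> \<longleftrightarrow> A *v \<alpha> = \<sigma>"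
  unfolding fiber_def phi_single
  by (auto dest!: arg_cong[of _ _ Poly_Mapping.keys])

lemma lookup_homogeneous_part:
  "Poly_Mapping.lookup (homogeneous_part A \<sigma> f) \<alpha> =
    (if A *v \<alpha> = \<sigma> then Poly_Mapping.lookup f \<alpha> else 0)"
  by (auto simp: homogeneous_part_def mem_fiber_iff lookup_sum lookup_single when_def in_keys_iff)

lemma keys_homogeneous_part:
  "Poly_Mapping.keys (homogeneous_part A \<sigma> f) = {\<alpha> \<in> Poly_Mapping.keys f. A *v \<alpha> = \<sigma>}"
  by (auto simp: in_keys_iff lookup_homogeneous_part split: if_splits)

lemma pi_map_homogeneous_part:
  fixes A :: "nat ^ 'n::finite ^ 'm::finite" and f :: "('k::comm_ring_1, 'n) mpoly"
  shows "pi_map t (homogeneous_part A \<sigma> f) js = (if length js = t then moment A \<sigma> js f else 0)"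
proof -
  have "(\<Prod>i<length js. (of_nat (\<alpha> $ (js ! i)) :: 'k)) = (\<Prod>j\<leftarrow>js. of_nat (\<alpha> $ j))" for \<alpha> :: "nat ^ 'n"
    by (simp add: prod.list_conv_set_nth lessThan_atLeast0)
  then show ?thesis
    by (auto simp: pi_map_def keys_homogeneous_part pure_tensor_def moment_def
        lookup_homogeneous_part mult.commute intro!: sum.cong)
qed

lemma mem_ker_graded_pi_iff:
  "f \<in> ker_graded_pi A t \<longleftrightarrow> Poly_Mapping.lookup f 0 = 0 \<and>
    (\<forall>\<sigma> js. length js = t \<longrightarrow> moment A \<sigma> js f = 0)"
  by (auto simp: ker_graded_pi_def graded_pi_def fun_eq_iff pi_map_homogeneous_part)

lemma fiber_space_eq:
  fixes A :: "nat ^ 'n::finite ^ 'm::finite"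
  shows "(fiber_space A \<sigma> :: ('k::comm_ring_1, 'n) mpoly set) = {f. homogeneous_part A \<sigma> f = f}"
proof -
  have m: "module (scale_mpoly :: 'k \<Rightarrow> ('k, 'n) mpoly \<Rightarrow> ('k, 'n) mpoly)"
    by unfold_locales
      (simp_all add: scale_mpoly_def distrib_left distrib_right single_add Poly_Mapping.mult_single
        flip: mult.assoc)
  have scale: "scale_mpoly c (mpmonom \<alpha>) = Poly_Mapping.single \<alpha> c" for c :: 'k and \<alpha> :: "nat ^ 'n"
    by (simp add: scale_mpoly_def Poly_Mapping.mult_single)
  have lookup_scale: "Poly_Mapping.lookup (scale_mpoly c f) \<alpha> = c * Poly_Mapping.lookup f \<alpha>"
    for c :: 'k and f :: "('k, 'n) mpoly" and \<alpha>
  proof -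
    have "scale_mpoly c f = (\<Sum>\<beta>\<in>Poly_Mapping.keys f. Poly_Mapping.single \<beta> (c * Poly_Mapping.lookup f \<beta>))"
      by (subst mpoly_sum_single[of f])
        (simp add: scale_mpoly_def sum_distrib_left Poly_Mapping.mult_single)
    then show ?thesis by (simp add: lookup_sum lookup_single when_def in_keys_iff)
  qed
  show ?thesis
  proof
    have "module.subspace scale_mpoly {f :: ('k, 'n) mpoly. homogeneous_part A \<sigma> f = f}"
      unfolding module.subspace_def[OF m]
      by (auto simp: poly_mapping_eq_iff fun_eq_iff lookup_homogeneous_part lookup_add lookup_scale)
    moreover have "(fiber A \<sigma> :: ('k, 'n) mpoly set) \<subseteq> {f. homogeneous_part A \<sigma> f = f}"
    proof
      fix f :: "('k, 'n) mpoly" assume f: "f \<in> fiber A \<sigma>"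
      then obtain \<alpha> where \<alpha>: "f = mpmonom \<alpha>" by (auto simp: fiber_def)
      then have "A *v \<alpha> = \<sigma>" using f by (simp add: mem_fiber_iff)
      then show "f \<in> {f. homogeneous_part A \<sigma> f = f}"
        by (auto simp: \<alpha> poly_mapping_eq_iff fun_eq_iff lookup_homogeneous_part lookup_single when_def)
    qed
    ultimately show "(fiber_space A \<sigma> :: ('k, 'n) mpoly set) \<subseteq> {f. homogeneous_part A \<sigma> f = f}"
      unfolding fiber_space_def by (intro module.span_minimal[OF m])
  next
    show "{f. homogeneous_part A \<sigma> f = f} \<subseteq> (fiber_space A \<sigma> :: ('k, 'n) mpoly set)"
    proof safe
      fix f :: "('k, 'n) mpoly" assume "homogeneous_part A \<sigma> f = f"
      then have "f = (\<Sum>\<alpha> | \<alpha> \<in> Poly_Mapping.keys f \<and> mpmonom \<alpha> \<in> (fiber A \<sigma> :: ('k, 'n) mpoly set).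
          scale_mpoly (Poly_Mapping.lookup f \<alpha>) (mpmonom \<alpha>))"
        by (simp add: homogeneous_part_def scale)
      also have "\<dots> \<in> fiber_space A \<sigma>"
        unfolding fiber_space_def
        by (intro module.span_sum[OF m] module.span_scale[OF m] module.span_base[OF m]) simp
      finally show "f \<in> fiber_space A \<sigma>" .
    qed
  qed
qed

lemma homogeneous_part_homogeneous_part:
  "homogeneous_part A \<sigma> (homogeneous_part A \<tau> f) = (if \<sigma> = \<tau> then homogeneous_part A \<tau> f else 0)"
  by (auto simp: poly_mapping_eq_iff fun_eq_iff lookup_homogeneous_part)

lemma homogeneous_part_sum:
  assumes "finite F" "\<And>\<tau>. \<tau> \<in> F \<Longrightarrow> homogeneous_part A \<tau> (w \<tau>) = w \<tau>"
  shows "homogeneous_part A \<sigma> (\<Sum>\<tau>\<in>F. w \<tau>) = (if \<sigma> \<in> F then w \<sigma> else 0)"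
proof (rule poly_mapping_eqI)
  fix \<alpha>
  have w: "Poly_Mapping.lookup (w \<tau>) \<alpha> = (if A *v \<alpha> = \<tau> then Poly_Mapping.lookup (w \<tau>) \<alpha> else 0)"
    if "\<tau> \<in> F" for \<tau>
    using assms(2)[OF that] lookup_homogeneous_part by metis
  have "(\<Sum>\<tau>\<in>F. Poly_Mapping.lookup (w \<tau>) \<alpha>) =
      (\<Sum>\<tau>\<in>F. if A *v \<alpha> = \<tau> then Poly_Mapping.lookup (w \<tau>) \<alpha> else 0)"
    by (rule sum.cong[OF refl w])
  also have "\<dots> = (if A *v \<alpha> \<in> F then Poly_Mapping.lookup (w (A *v \<alpha>)) \<alpha> else 0)"
    using assms(1) by (simp add: sum.delta)
  finally show "Poly_Mapping.lookup (homogeneous_part A \<sigma> (\<Sum>\<tau>\<in>F. w \<tau>)) \<alpha> =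
      Poly_Mapping.lookup (if \<sigma> \<in> F then w \<sigma> else 0) \<alpha>"
    using w[of \<sigma>] by (auto simp: lookup_homogeneous_part lookup_sum)
qed

lemma sum_homogeneous_parts:
  assumes "finite F" "(*v) A ` Poly_Mapping.keys f \<subseteq> F"
  shows "(\<Sum>\<sigma>\<in>F. homogeneous_part A \<sigma> f) = f"
  by (rule poly_mapping_eqI)
    (use assms in \<open>auto simp: lookup_sum lookup_homogeneous_part in_keys_iff image_subset_iff\<close>)

text \<open>
  The condition on \<open>theta\<close> concerns the moments of all degrees up to \<open>t\<close>, the kernel only those of
  degree \<open>t\<close>. For \<open>\<sigma> \<noteq> 0\<close> the latter imply the former. The fiber of \<open>0\<close> is \<open>{1}\<close>, the columns of \<open>A\<close>
  being non-zero, and its moment of degree \<open>0\<close> is the constant term.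
\<close>
lemma mem_symbolic_power_iff_ker_graded_pi:
  fixes A :: "nat ^ 'n::finite ^ 'm::finite" and f :: "('k::field_char_0, 'n) mpoly"
  assumes A: "\<And>i. column i A \<noteq> 0" and t: "t \<ge> 1"
  shows "f \<in> symbolic_power (toric_ideal A) (t + 1) \<longleftrightarrow> f \<in> ker_graded_pi A t"
proof -
  interpret toric A "TYPE('k)" .
  have zero: "moment A 0 js f = (\<Prod>j\<leftarrow>js. of_nat ((0 :: nat ^ 'n) $ j)) * Poly_Mapping.lookup f 0" for js
  proof -
    have "moment A 0 js f = (\<Sum>\<alpha>\<in>{0} \<inter> Poly_Mapping.keys f.
        (\<Prod>j\<leftarrow>js. of_nat (\<alpha> $ j)) * Poly_Mapping.lookup f \<alpha>)"
      unfolding moment_def by (rule sum.cong) (auto simp: matrix_vector_eq_zero_iff[OF A])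
    then show ?thesis
      by (cases "0 \<in> Poly_Mapping.keys f") (auto simp: in_keys_iff)
  qed
  have "f \<in> Q (t + 1) \<longleftrightarrow> (\<forall>js. length js \<le> t \<longrightarrow> (\<forall>\<sigma>. moment A \<sigma> js f = 0))"
    by (simp add: symbolic_power_iff_theta foldr_theta_mem_toric_ideal_iff less_Suc_eq_le)
  also have "\<dots> \<longleftrightarrow> f \<in> ker_graded_pi A t"
  proof
    assume *: "\<forall>js. length js \<le> t \<longrightarrow> (\<forall>\<sigma>. moment A \<sigma> js f = 0)"
    then have "moment A 0 [] f = 0" by simp
    then show "f \<in> ker_graded_pi A t" using * by (simp add: mem_ker_graded_pi_iff zero)
  next
    assume "f \<in> ker_graded_pi A t"
    then have f: "Poly_Mapping.lookup f 0 = 0" "\<And>\<sigma> js. length js = t \<Longrightarrow> moment A \<sigma> js f = 0"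
      by (simp_all add: mem_ker_graded_pi_iff)
    show "\<forall>js. length js \<le> t \<longrightarrow> (\<forall>\<sigma>. moment A \<sigma> js f = 0)"
    proof safe
      fix js :: "'n list" and \<sigma> assume "length js \<le> t"
      then show "moment A \<sigma> js f = 0"
        using moment_lower_degree[of \<sigma> t A f js] f by (cases "\<sigma> = 0") (simp_all add: zero)
    qed
  qed
  finally show ?thesis .
qed

lemma is_direct_sum_ker_graded_pi:
  fixes A :: "nat ^ 'n::finite ^ 'm::finite"
  assumes A: "\<And>i. column i A \<noteq> 0"
  shows "is_direct_sum (ker_graded_pi A t :: ('k::comm_ring_1, 'n) mpoly set)
    {\<sigma>. \<sigma> \<noteq> 0} (\<lambda>\<sigma>. ker_pi_on t (fiber_space A \<sigma>))"
proof -
  let ?W = "\<lambda>\<sigma>. ker_pi_on t (fiber_space A \<sigma>) :: ('k, 'n) mpoly set"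
  have W: "homogeneous_part A \<sigma> f = f \<and> pi_map t f = (\<lambda>_. 0)" if "f \<in> ?W \<sigma>" for f \<sigma>
    using that by (simp add: ker_pi_on_def fiber_space_eq)
  have part: "homogeneous_part A \<sigma> (\<Sum>\<tau>\<in>F. w \<tau>) = (if \<sigma> \<in> F then w \<sigma> else 0)"
    if "finite F" "\<forall>\<sigma>\<in>F. w \<sigma> \<in> ?W \<sigma>" for F w \<sigma>
    using that W by (intro homogeneous_part_sum) auto
  show ?thesis
    unfolding is_direct_sum_def
  proof (intro conjI allI impI)
    show "ker_graded_pi A t = {\<Sum>\<sigma>\<in>F. w \<sigma> | F w. finite F \<and> F \<subseteq> {\<sigma>. \<sigma> \<noteq> 0} \<and> (\<forall>\<sigma>\<in>F. w \<sigma> \<in> ?W \<sigma>)}"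
    proof (intro equalityI subsetI)
      fix f :: "('k, 'n) mpoly" assume f: "f \<in> ker_graded_pi A t"
      let ?F = "(*v) A ` Poly_Mapping.keys f"
      have sum: "f = (\<Sum>\<sigma>\<in>?F. homogeneous_part A \<sigma> f)"
        by (rule sum_homogeneous_parts[symmetric]) auto
      have nz: "?F \<subseteq> {\<sigma>. \<sigma> \<noteq> 0}"
        using f by (auto simp: ker_graded_pi_def matrix_vector_eq_zero_iff[OF A] in_keys_iff)
      have mem: "homogeneous_part A \<sigma> f \<in> ?W \<sigma>" for \<sigma>
        using f by (simp add: ker_pi_on_def fiber_space_eq homogeneous_part_homogeneous_part
            ker_graded_pi_def graded_pi_def fun_eq_iff)
      show "f \<in> {\<Sum>\<sigma>\<in>F. w \<sigma> | F w. finite F \<and> F \<subseteq> {\<sigma>. \<sigma> \<noteq> 0} \<and> (\<forall>\<sigma>\<in>F. w \<sigma> \<in> ?W \<sigma>)}"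
        by (intro CollectI exI[of _ ?F] exI[of _ "\<lambda>\<sigma>. homogeneous_part A \<sigma> f"]
            conjI ballI finite_imageI finite_keys sum nz mem)
    next
      fix f assume "f \<in> {\<Sum>\<sigma>\<in>F. w \<sigma> | F w. finite F \<and> F \<subseteq> {\<sigma>. \<sigma> \<noteq> 0} \<and> (\<forall>\<sigma>\<in>F. w \<sigma> \<in> ?W \<sigma>)}"
      then obtain F w where F: "finite F" "F \<subseteq> {\<sigma>. \<sigma> \<noteq> 0}" "\<forall>\<sigma>\<in>F. w \<sigma> \<in> ?W \<sigma>"
        and f: "f = (\<Sum>\<sigma>\<in>F. w \<sigma>)"
        by blast
      have "homogeneous_part A 0 f = 0"
        using part[OF F(1,3), of 0] F(2) by (auto simp: f)
      then have "Poly_Mapping.lookup (homogeneous_part A 0 f) 0 = 0" by simp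
      then have "Poly_Mapping.lookup f 0 = 0"
        by (simp add: lookup_homogeneous_part matrix_vector_eq_zero_iff[OF A])
      moreover have "pi_map t (homogeneous_part A \<sigma> f) = (\<lambda>_. 0)" for \<sigma>
        using part[OF F(1,3), of \<sigma>] W F(3) by (auto simp: f pi_map_def)
      ultimately show "f \<in> ker_graded_pi A t"
        by (simp add: ker_graded_pi_def graded_pi_def)
    qed
  next
    fix F w
    assume F: "finite F \<and> F \<subseteq> {\<sigma>. \<sigma> \<noteq> 0} \<and> (\<forall>\<sigma>\<in>F. w \<sigma> \<in> ?W \<sigma>) \<and> (\<Sum>\<sigma>\<in>F. w \<sigma>) = 0"
    have "homogeneous_part A \<sigma> 0 = (0 :: ('k, 'n) mpoly)" for \<sigma>
      by (simp add: homogeneous_part_def)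
    then show "\<forall>\<sigma>\<in>F. w \<sigma> = 0" using part[of F w] F by metis
  qed
qed

theorem theorem2p9:
  fixes A :: "nat ^ 'n::finite ^ 'm::finite"
    and t :: nat
  assumes "\<And>i. column i A \<noteq> 0"
    and "t \<ge> 1"
  shows "symbolic_power (toric_ideal A :: ('k::{alg_closed_field, field_char_0}, 'n) mpoly set) (t + 1)
           = ker_graded_pi A t \<and>
         is_direct_sum (ker_graded_pi A t :: ('k, 'n) mpoly set)
           {\<sigma>. \<sigma> \<noteq> 0} (\<lambda>\<sigma>. ker_pi_on t (fiber_space A \<sigma>))"
  using mem_symbolic_power_iff_ker_graded_pi[OF assms] is_direct_sum_ker_graded_pi[OF assms(1)]
  by blast

end
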